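(* Any algorithm $\mathcal{A}'$ for the Satisfied Superset problem can be transformed (in polynomial time) into an algorithm $\mathcal{A}$ for the Rectangulation problem such that for all inputs $X$ (permutation point sets) we have $\mathcal{A}(X) = O(\mathcal{A}'(X))$.
   Context: Permutation point sets: for a permutation $(x_1,\dots,x_n)$ of $[n]=\{1,\dots,n\}$, the associated point set is $X=\{(x_i,i): i\in[n]\}$. An algorithm for a problem below takes any permutation point set $X$ as input and outputs a feasible solution; $\mathcal{A}(X)$ denotes its cost on $X$. Satisfied Superset problem: a point set $Y\subseteq[n]\times[n]$ is satisfied if for any two points $a,b\in Y$, either $a,b$ lie on a common horizontal or vertical line, or the closed axis-parallel rectangle with corners $a$ and $b$ contains some point of $Y\setminus\{a,b\}$ (possibly on its boundary). Given $X$ of size $n$, an algorithm outputs a satisfied $Y$ with $X\subseteq Y\subseteq[n]\times[n]$; its cost is $|Y|$. Rectangulation problem: let $S=\{0,1,\dots,n+1\}^2$, corner points $C=\{(0,0),(0,n+1),(n+1,0),(n+1,n+1)\}$, margin points $M=\{(i,0),(i,n+1),(0,i),(n+1,i): i\in[n]\}$; points of $[n]\times[n]$ are non-margin. A state $(P,L)$ consists of $P\subseteq S\setminus C$ and a set $L$ of horizontal and vertical segments with endpoints in $P$. It is valid iff (i) each segment of $L$ contains exactly two points of $P$, namely its endpoints; (ii) no two segments of $L$ intersect except possibly at endpoints; (iii) (elbow-free) each non-margin point of $P$ lies on at least two segments of $L$, and if it lies on exactly two, they have the same orientation. The initial state for $X$ is $P_0=X\cup M$ and $L_0$ containing, for each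 $(x,y)\in X$, the vertical segments $[(x,0),(x,y)]$ and $[(x,y),(x,n+1)]$. An end state is a valid state $(P^*,L^* )$ with $P^*\supseteq P_0$ and all segments of $L^*$ horizontal, covering every point of $\{0,1,\dots,n+1\}\times[n]$. A flip $\langle a,b\rangle$ ($a,b\in S\setminus C$) transforms $(P,L)$ into $(P',L')$: $P'=P\cup\{a,b\}$, $L'=L\cup\{[a,b]\}$, and any segment $[x,y]\in L$ containing $a$ in its interior is replaced by $[x,a],[a,y]$ (similarly for $b$). The flip is valid if $[a,b]$ is horizontal or vertical and $(P',L')$ is valid; after a flip any number of segments may be removed, provided the state stays valid (removals cost nothing). An algorithm transforms the initial state into some end state by valid flips; its cost is the number of flips. *)

theory Defs
  imports "HOL-Combinatorics.Permutations" "HOL-Library.Product_Lexorder"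
begin

type_synonym point = "nat \<times> nat"

definition perm_point_set :: "point set \<Rightarrow> bool" where
  "perm_point_set X \<longleftrightarrow>
     (\<exists>n x. x permutes {1..n} \<and> X = (\<lambda>i. (x i, i)) ` {1..n})"

text \<open>Lattice points of the closed axis-parallel rectangle with opposite corners \<open>a\<close> and \<open>b\<close>.\<close>

definition rectangle :: "point \<Rightarrow> point \<Rightarrow> point set" where
  "rectangle a b =
     {min (fst a) (fst b)..max (fst a) (fst b)} \<times> {min (snd a) (snd b)..max (snd a) (snd b)}"

definition satisfied :: "point set \<Rightarrow> bool" where
  "satisfied Y \<longleftrightarrow>
     (\<forall>a\<in>Y. \<forall>b\<in>Y. snd a = snd b \<or> fst a = fst b \<or>
        (\<exists>c \<in> Y - {a, b}. c \<in> rectangle a b))"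

definition superset_solution :: "point set \<Rightarrow> point set \<Rightarrow> bool" where
  "superset_solution X Y \<longleftrightarrow>
     X \<subseteq> Y \<and> Y \<subseteq> {1..card X} \<times> {1..card X} \<and> satisfied Y"

definition superset_cost :: "point set \<Rightarrow> nat" where
  "superset_cost Y = card Y"

definition superset_algorithm :: "(point set \<Rightarrow> point set) \<Rightarrow> bool" where
  "superset_algorithm A \<longleftrightarrow> (\<forall>X. perm_point_set X \<longrightarrow> superset_solution X (A X))"

definition grid :: "nat \<Rightarrow> point set" where
  "grid n = {0..n + 1} \<times> {0..n + 1}"

definition corners :: "nat \<Rightarrow> point set" where
  "corners n = {(0, 0), (0, n + 1), (n + 1, 0), (n + 1, n + 1)}"

definition margin :: "nat \<Rightarrow> point set" where
  "margin n = (\<Union>i\<in>{1..n}. {(i, 0), (i, n + 1), (0, i), (n + 1, i)})"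

definition non_margin :: "nat \<Rightarrow> point set" where
  "non_margin n = {1..n} \<times> {1..n}"

text \<open>
  A segment is stored as the pair of its endpoints, the left one (horizontal segments) or the
  lower one (vertical segments) first; \<open>horizontal\<close> and \<open>vertical\<close> include this orientation and
  exclude degenerate segments, so every segment has exactly one representation.
\<close>

type_synonym segment = "point \<times> point"

definition horizontal :: "segment \<Rightarrow> bool" where
  "horizontal s \<longleftrightarrow> snd (fst s) = snd (snd s) \<and> fst (fst s) < fst (snd s)"

definition vertical :: "segment \<Rightarrow> bool" where
  "vertical s \<longleftrightarrow> fst (fst s) = fst (snd s) \<and> snd (fst s) < snd (snd s)"

definition seg :: "point \<Rightarrow> point \<Rightarrow> segment" where
  "seg a b = (if fst a < fst b \<or> snd a < snd b then (a, b) else (b, a))"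

definition endpoints :: "segment \<Rightarrow> point set" where
  "endpoints s = {fst s, snd s}"

definition seg_points :: "segment \<Rightarrow> point set" where
  "seg_points s = rectangle (fst s) (snd s)"

definition seg_interior :: "segment \<Rightarrow> point set" where
  "seg_interior s = seg_points s - endpoints s"

type_synonym state = "point set \<times> segment set"

text \<open>
  Only lattice points of segments are considered.  This loses nothing in the non-crossing
  condition: a perpendicular crossing is a lattice point, and if two distinct collinear segments
  overlap, then an endpoint of one is interior to the other, which the condition that a segment
  contains no points of \<open>P\<close> besides its endpoints excludes.
\<close>

definition valid_state :: "nat \<Rightarrow> state \<Rightarrow> bool" where
  "valid_state n = (\<lambda>(P, L).
     P \<subseteq> grid n - corners n \<and>
     (\<forall>s\<in>L. (horizontal s \<or> vertical s) \<and> endpoints s \<subseteq> P) \<and>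
     (\<forall>s\<in>L. seg_points s \<inter> P = endpoints s) \<and>
     (\<forall>s\<in>L. \<forall>t\<in>L. s \<noteq> t \<longrightarrow> seg_points s \<inter> seg_points t \<subseteq> endpoints s \<inter> endpoints t) \<and>
     (\<forall>p \<in> P \<inter> non_margin n.
        let I = {s\<in>L. p \<in> seg_points s}
        in card I \<ge> 2 \<and> (card I = 2 \<longrightarrow> (\<forall>s\<in>I. horizontal s) \<or> (\<forall>s\<in>I. vertical s))))"

definition initial_state :: "point set \<Rightarrow> state" where
  "initial_state X =
     (X \<union> margin (card X),
      (\<Union>(x, y)\<in>X. {((x, 0), (x, y)), ((x, y), (x, card X + 1))}))"

definition end_state :: "point set \<Rightarrow> state \<Rightarrow> bool" where
  "end_state X = (\<lambda>(P, L).
     valid_state (card X) (P, L) \<and>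
     fst (initial_state X) \<subseteq> P \<and>
     (\<forall>s\<in>L. horizontal s) \<and>
     {0..card X + 1} \<times> {1..card X} \<subseteq> (\<Union>s\<in>L. seg_points s))"

definition split_at :: "point \<Rightarrow> segment set \<Rightarrow> segment set" where
  "split_at c L =
     {s\<in>L. c \<notin> seg_interior s} \<union>
     (\<Union>s\<in>{s\<in>L. c \<in> seg_interior s}. {(fst s, c), (c, snd s)})"

definition flip :: "point \<Rightarrow> point \<Rightarrow> state \<Rightarrow> state" where
  "flip a b = (\<lambda>(P, L). (P \<union> {a, b}, insert (seg a b) (split_at b (split_at a L))))"

definition valid_flip :: "nat \<Rightarrow> point \<Rightarrow> point \<Rightarrow> state \<Rightarrow> bool" where
  "valid_flip n a b st \<longleftrightarrow>
     a \<in> grid n - corners n \<and> b \<in> grid n - corners n \<and>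
     (horizontal (seg a b) \<or> vertical (seg a b)) \<and> valid_state n (flip a b st)"

definition remove_segments :: "segment list \<Rightarrow> state \<Rightarrow> state" where
  "remove_segments R = (\<lambda>(P, L). (P, L - set R))"

text \<open>A step consists of the two points of a flip and the segments removed after this flip;
  listing a segment that is not present has no effect.\<close>

type_synonym step = "(point \<times> point) \<times> segment list"

fun legal_run :: "nat \<Rightarrow> state \<Rightarrow> step list \<Rightarrow> state \<Rightarrow> bool" where
  "legal_run n st [] st' \<longleftrightarrow> st' = st"
| "legal_run n st (((a, b), R) # steps) st' \<longleftrightarrow>
     valid_flip n a b st \<and>
     valid_state n (remove_segments R (flip a b st)) \<and>
     legal_run n (remove_segments R (flip a b st)) steps st'"

definition rectangulation_solution :: "point set \<Rightarrow> step list \<Rightarrow> bool" where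
  "rectangulation_solution X steps \<longleftrightarrow>
     (\<exists>st. legal_run (card X) (initial_state X) steps st \<and> end_state X st)"

definition rectangulation_cost :: "step list \<Rightarrow> nat" where
  "rectangulation_cost steps = length steps"

definition rectangulation_algorithm :: "(point set \<Rightarrow> step list) \<Rightarrow> bool" where
  "rectangulation_algorithm A \<longleftrightarrow>
     (\<forall>X. perm_point_set X \<longrightarrow> rectangulation_solution X (A X))"

text \<open>
  The machine model is a first-order functional language over binary trees, in the style of
  Jones' language \<open>F\<close>.  Its only primitives are constructing a node, selecting a child and
  testing for a leaf.  Each of them takes constant time on a pointer representation of trees,
  and the number of arguments of a call is bounded by the program, so evaluation cost is
  polynomially related to running time on random access machines and Turing machines.
\<close>

datatype tree = Leaf | Node tree tree

fun left_child :: "tree \<Rightarrow> tree" where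
  "left_child Leaf = Leaf"
| "left_child (Node l r) = l"

fun right_child :: "tree \<Rightarrow> tree" where
  "right_child Leaf = Leaf"
| "right_child (Node l r) = r"

datatype expr =
    Arg nat
  | MkLeaf
  | MkNode expr expr
  | LeftOf expr
  | RightOf expr
  | IfNode expr expr expr
  | Call nat "expr list"

text \<open>
  A program is the list of the bodies of its (mutually recursive) functions, with \<open>Arg i\<close>
  referring to the \<open>i\<close>-th argument.  The last argument of \<open>eval\<close> and \<open>evals\<close> is the cost.
\<close>

type_synonym program = "expr list"

inductive
  eval :: "program \<Rightarrow> tree list \<Rightarrow> expr \<Rightarrow> tree \<Rightarrow> nat \<Rightarrow> bool" and
  evals :: "program \<Rightarrow> tree list \<Rightarrow> expr list \<Rightarrow> tree list \<Rightarrow> nat \<Rightarrow> bool"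
  for p :: program
where
  Arg: "i < length env \<Longrightarrow> eval p env (Arg i) (env ! i) 1"
| MkLeaf: "eval p env MkLeaf Leaf 1"
| MkNode: "eval p env e1 v1 t1 \<Longrightarrow> eval p env e2 v2 t2 \<Longrightarrow>
    eval p env (MkNode e1 e2) (Node v1 v2) (t1 + t2 + 1)"
| LeftOf: "eval p env e v t \<Longrightarrow> eval p env (LeftOf e) (left_child v) (t + 1)"
| RightOf: "eval p env e v t \<Longrightarrow> eval p env (RightOf e) (right_child v) (t + 1)"
| IfNode_True: "eval p env e (Node l r) t \<Longrightarrow> eval p env e1 v t1 \<Longrightarrow>
    eval p env (IfNode e e1 e2) v (t + t1 + 1)"
| IfNode_False: "eval p env e Leaf t \<Longrightarrow> eval p env e2 v t2 \<Longrightarrow>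
    eval p env (IfNode e e1 e2) v (t + t2 + 1)"
| Call: "evals p env es vs t \<Longrightarrow> f < length p \<Longrightarrow> eval p vs (p ! f) v t' \<Longrightarrow>
    eval p env (Call f es) v (t + t' + 1)"
| Nil: "evals p env [] [] 0"
| Cons: "eval p env e v t \<Longrightarrow> evals p env es vs t' \<Longrightarrow>
    evals p env (e # es) (v # vs) (t + t')"

text \<open>
  \<open>polytime_on D encode_in encode_out f\<close>: some program, started with its function 0 on the code
  of an input from \<open>D\<close>, returns the code of the value of \<open>f\<close> in time polynomial in the size of
  the input code.  The \<open>size\<close> of a tree is its number of inner nodes.
\<close>

definition polytime_on :: "'a set \<Rightarrow> ('a \<Rightarrow> tree) \<Rightarrow> ('b \<Rightarrow> tree) \<Rightarrow> ('a \<Rightarrow> 'b) \<Rightarrow> bool" where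
  "polytime_on D encode_in encode_out f \<longleftrightarrow>
     (\<exists>(p :: program) (c :: nat) (k :: nat). \<forall>a\<in>D.
        \<exists>t \<le> c * size (encode_in a) ^ k + c.
          eval p [encode_in a] (Call 0 [Arg 0]) (encode_out (f a)) t)"

text \<open>
  Coordinates are coded in unary.  They are at most \<open>n + 1\<close> for an instance with \<open>n\<close> points, so
  code sizes of instances and solutions are polynomial in \<open>n\<close>.
\<close>

fun encode_nat :: "nat \<Rightarrow> tree" where
  "encode_nat 0 = Leaf"
| "encode_nat (Suc n) = Node Leaf (encode_nat n)"

fun encode_pair :: "('a \<Rightarrow> tree) \<Rightarrow> ('b \<Rightarrow> tree) \<Rightarrow> 'a \<times> 'b \<Rightarrow> tree" where
  "encode_pair f g (a, b) = Node (f a) (g b)"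

fun encode_list :: "('a \<Rightarrow> tree) \<Rightarrow> 'a list \<Rightarrow> tree" where
  "encode_list f [] = Leaf"
| "encode_list f (x # xs) = Node (f x) (encode_list f xs)"

definition encode_point :: "point \<Rightarrow> tree" where
  "encode_point = encode_pair encode_nat encode_nat"

text \<open>A finite set of points is coded as the list of its elements in lexicographic order.\<close>

definition encode_points :: "point set \<Rightarrow> tree" where
  "encode_points Y = encode_list encode_point (sorted_list_of_set Y)"

definition encode_steps :: "step list \<Rightarrow> tree" where
  "encode_steps =
     encode_list
       (encode_pair (encode_pair encode_point encode_point)
         (encode_list (encode_pair encode_point encode_point)))"

end

theory Submission
  imports Defs
begin

text \<open>
  A superset solution \<open>Y\<close> is turned into flips in two phases.  First every column is subdivided at
  the points of \<open>Y\<close>, by flips along the vertical pieces between consecutive points.  Then the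
  horizontal pieces between consecutive points of \<open>Y\<close> and the margin are added, sorted by
  increasing right end and, for equal right ends, by decreasing left end; a vertical piece is
  removed as soon as all horizontal pieces at its two endpoints are present.

  No flip is blocked: suppose that a horizontal piece \<open>g\<close> crosses a vertical piece \<open>v\<close>.  As \<open>Y\<close> is
  satisfied and neither piece contains points of \<open>Y\<close> in its interior, the neighbours of an endpoint
  of \<open>v\<close> in its row lie no further out than the ends of \<open>g\<close>.  So the horizontal pieces at \<open>v\<close>
  precede \<open>g\<close> in the order, and \<open>v\<close> has been removed before \<open>g\<close> is added.  There are at most
  \<open>card Y + card X \<le> 2 * card Y\<close> pieces of each orientation.
\<close>

section \<open>The transformation\<close>

text \<open>In the second phase the two validity conditions pull in opposite directions: a vertical
  piece kept too long blocks a horizontal one, and a vertical piece removed too early leaves an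
  elbow at a point whose row is still incomplete. Subdividing all columns first separates the two
  concerns. The point set then stays fixed, every inner point has two potential neighbours in each
  orientation, and an elbow is excluded as soon as all pieces of one orientation at the point are
  present. The removal rule guarantees this for any order of the horizontal pieces, because a
  horizontal piece still missing at a point keeps both vertical pieces there. Only the absence of
  crossings depends on the order and on satisfaction. The second sort criterion is forced: a
  horizontal piece that starts at an end of \<open>v\<close> may have the same right end as
  \<open>g\<close>, and then only its larger left end tells that it must come earlier.\<close>

text \<open>
  The flag \<open>b\<close> stands for an orientation, with \<open>True\<close> for horizontal: \<open>co b\<close> is the coordinate that
  is constant along segments of this orientation, and \<open>co (\<not> b)\<close> the one that varies.
\<close>

definition co :: "bool \<Rightarrow> point \<Rightarrow> nat" where
  "co b p = (if b then snd p else fst p)"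

definition mk :: "bool \<Rightarrow> nat \<Rightarrow> nat \<Rightarrow> point" where
  "mk b a c = (if b then (c, a) else (a, c))"

definition between :: "bool \<Rightarrow> point set \<Rightarrow> point \<Rightarrow> point \<Rightarrow> bool" where
  "between b P p q \<longleftrightarrow>
     (\<exists>r\<in>P. co b r = co b p \<and> co (\<not> b) p < co (\<not> b) r \<and> co (\<not> b) r < co (\<not> b) q)"

definition consecutive :: "bool \<Rightarrow> point set \<Rightarrow> point \<Rightarrow> point \<Rightarrow> bool" where
  "consecutive b P p q \<longleftrightarrow>
     co b p = co b q \<and> co (\<not> b) p < co (\<not> b) q \<and> \<not> between b P p q"

text \<open>For a permutation point set the coordinates \<open>co b\<close> of \<open>xs\<close> run
  through 1, ..., n exactly once. Reading the margin off \<open>xs\<close> in this way spares the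
  program a counting loop. Only the margin points at the two ends of lines of orientation
  \<open>b\<close> are produced.\<close>

definition border :: "bool \<Rightarrow> nat \<Rightarrow> point list \<Rightarrow> point list \<Rightarrow> point list" where
  "border b N xs ys = concat (map (\<lambda>p. [mk b (co b p) 0, mk b (co b p) N]) xs) @ ys"

definition pieces :: "bool \<Rightarrow> point list \<Rightarrow> segment list" where
  "pieces b B = filter (\<lambda>(p, q). consecutive b (set B) p q) (List.product B B)"

text \<open>Integers allow the sign change by which the lexicographic order puts larger left ends
  first.\<close>

definition sort_index :: "segment \<Rightarrow> int \<times> int" where
  "sort_index s = (int (fst (snd s)), - int (fst (fst s)))"

definition touches :: "segment \<Rightarrow> segment \<Rightarrow> bool" where
  "touches v g \<longleftrightarrow> endpoints v \<inter> endpoints g \<noteq> {}"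

text \<open>The removal list is recomputed from all of \<open>V\<close> in every step, so it repeats
  pieces removed long before. This is harmless for \<open>remove_segments\<close> and makes it
  unnecessary to carry the current state along.\<close>

fun sweep :: "segment list \<Rightarrow> segment list \<Rightarrow> step list" where
  "sweep V [] = []"
| "sweep V (g # gs) = (g, filter (\<lambda>v. \<not> (\<exists>h\<in>set gs. touches v h)) V) # sweep V gs"

text \<open>Stated on lists because a program works on an enumeration of the sets;
  \<open>transform\<close> uses the same enumeration as \<open>encode_points\<close>.\<close>

definition transform_lists :: "point list \<Rightarrow> point list \<Rightarrow> step list" where
  "transform_lists xs ys =
     (let N = length xs + 1;
          V = pieces False (border False N xs ys);
          G = sort_key sort_index (pieces True (border True N xs ys))
      in map (\<lambda>v. (v, [])) V @ sweep V G)"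

definition transform :: "point set \<times> point set \<Rightarrow> step list" where
  "transform = (\<lambda>(X, Y). transform_lists (sorted_list_of_set X) (sorted_list_of_set Y))"

section \<open>A polynomial-time program\<close>

definition encode_bool :: "bool \<Rightarrow> tree" where
  "encode_bool b = (if b then Node Leaf Leaf else Leaf)"

abbreviation "encode_seg \<equiv> encode_pair encode_point encode_point"

text \<open>
  These derived expressions are constants, not abbreviations, so that their evaluation rules
  \<open>ev_e_cond\<close>, \<open>ev_e_and\<close>, ... are selected by matching and do not compete with those of \<open>IfNode\<close>.
\<close>

definition "e_true = MkNode MkLeaf MkLeaf"
definition "e_cond c d e = IfNode c d e"
definition "e_and d e = IfNode d e MkLeaf"
definition "e_or d e = IfNode d e_true e"
definition "e_not d = IfNode d MkLeaf e_true"
definition "e_co i d = IfNode (Arg i) (RightOf d) (LeftOf d)"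
definition "e_nco i d = IfNode (Arg i) (LeftOf d) (RightOf d)"
definition "e_mk i d e = IfNode (Arg i) (MkNode e d) (MkNode d e)"
definition "e_lt d e = Call 1 [d, e]"
definition "e_eq d e = Call 2 [d, e]"

definition "p_main =
    Call 15 [Call 14 [LeftOf (Arg 0), RightOf (Arg 0), MkLeaf],
             Call 9 [Call 14 [LeftOf (Arg 0), RightOf (Arg 0), e_true]]]"

definition "p_lt =
    IfNode (Arg 1) (IfNode (Arg 0) (e_lt (RightOf (Arg 0)) (RightOf (Arg 1))) e_true) MkLeaf"

text \<open>Comparing arbitrary trees serves for coordinates and for points alike, since their codes
  are injective.\<close>

definition "p_eq =
    IfNode (Arg 0)
      (IfNode (Arg 1)
        (e_and (e_eq (LeftOf (Arg 0)) (LeftOf (Arg 1))) (e_eq (RightOf (Arg 0)) (RightOf (Arg 1))))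
        MkLeaf)
      (IfNode (Arg 1) MkLeaf e_true)"

text \<open>The base case yields one rather than zero, because the upper margin coordinate is the
  number of points plus one.\<close>

definition "p_count =
    IfNode (Arg 0) (MkNode MkLeaf (Call 3 [RightOf (Arg 0)])) (MkNode MkLeaf MkLeaf)"

definition "p_border =
    IfNode (Arg 0)
      (MkNode (e_mk 2 (e_co 2 (LeftOf (Arg 0))) MkLeaf)
        (MkNode (e_mk 2 (e_co 2 (LeftOf (Arg 0))) (Arg 1))
          (Call 4 [RightOf (Arg 0), Arg 1, Arg 2, Arg 3])))
      (Arg 3)"

definition "p_blocked =
    IfNode (Arg 0)
      (e_or
        (e_and (e_eq (e_co 3 (LeftOf (Arg 0))) (e_co 3 (Arg 1)))
          (e_and (e_lt (e_nco 3 (Arg 1)) (e_nco 3 (LeftOf (Arg 0))))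
            (e_lt (e_nco 3 (LeftOf (Arg 0))) (e_nco 3 (Arg 2)))))
        (Call 5 [RightOf (Arg 0), Arg 1, Arg 2, Arg 3]))
      MkLeaf"

text \<open>\<open>Arg 4\<close> is the result for the remaining first components, already computed
  by \<open>p_outer\<close>. Ending the list with it replaces an append function.\<close>

definition "p_inner =
    IfNode (Arg 0)
      (e_cond
        (e_and (e_eq (e_co 3 (Arg 1)) (e_co 3 (LeftOf (Arg 0))))
          (e_and (e_lt (e_nco 3 (Arg 1)) (e_nco 3 (LeftOf (Arg 0))))
            (e_not (Call 5 [Arg 2, Arg 1, LeftOf (Arg 0), Arg 3]))))
        (MkNode (MkNode (Arg 1) (LeftOf (Arg 0)))
          (Call 6 [RightOf (Arg 0), Arg 1, Arg 2, Arg 3, Arg 4]))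
        (Call 6 [RightOf (Arg 0), Arg 1, Arg 2, Arg 3, Arg 4]))
      (Arg 4)"

definition "p_outer =
    IfNode (Arg 0)
      (Call 6 [Arg 1, LeftOf (Arg 0), Arg 1, Arg 2, Call 7 [RightOf (Arg 0), Arg 1, Arg 2]])
      MkLeaf"

text \<open>The test is \<open>sort_index g \<le> sort_index h\<close>, with the comparison of
  negated left ends written as a negated \<open><\<close>. As in \<open>insort_key\<close>, equal
  keys go in front, so the resulting list is literally that of \<open>sort_key\<close>.\<close>

definition "p_insort =
    IfNode (Arg 1)
      (e_cond
        (e_or (e_lt (LeftOf (RightOf (Arg 0))) (LeftOf (RightOf (LeftOf (Arg 1)))))
          (e_and (e_eq (LeftOf (RightOf (Arg 0))) (LeftOf (RightOf (LeftOf (Arg 1)))))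
            (e_not (e_lt (LeftOf (LeftOf (Arg 0))) (LeftOf (LeftOf (LeftOf (Arg 1))))))))
        (MkNode (Arg 0) (Arg 1))
        (MkNode (LeftOf (Arg 1)) (Call 8 [Arg 0, RightOf (Arg 1)])))
      (MkNode (Arg 0) MkLeaf)"

definition "p_sort =
    IfNode (Arg 0) (Call 8 [LeftOf (Arg 0), Call 9 [RightOf (Arg 0)]]) MkLeaf"

definition "p_touch =
    IfNode (Arg 0)
      (e_or
        (e_or
          (e_or (e_eq (LeftOf (Arg 1)) (LeftOf (LeftOf (Arg 0))))
            (e_eq (LeftOf (Arg 1)) (RightOf (LeftOf (Arg 0)))))
          (e_or (e_eq (RightOf (Arg 1)) (LeftOf (LeftOf (Arg 0))))
            (e_eq (RightOf (Arg 1)) (RightOf (LeftOf (Arg 0))))))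
        (Call 10 [RightOf (Arg 0), Arg 1]))
      MkLeaf"

definition "p_remaining =
    IfNode (Arg 0)
      (e_cond (e_not (Call 10 [Arg 1, LeftOf (Arg 0)]))
        (MkNode (LeftOf (Arg 0)) (Call 11 [RightOf (Arg 0), Arg 1]))
        (Call 11 [RightOf (Arg 0), Arg 1]))
      MkLeaf"

definition "p_sweep =
    IfNode (Arg 0)
      (MkNode (MkNode (LeftOf (Arg 0)) (Call 11 [Arg 1, RightOf (Arg 0)]))
        (Call 12 [RightOf (Arg 0), Arg 1]))
      MkLeaf"

definition "p_subdivide =
    IfNode (Arg 0)
      (MkNode (MkNode (LeftOf (Arg 0)) MkLeaf) (Call 13 [RightOf (Arg 0), Arg 1]))
      (Arg 1)"

definition "p_pieces =
    Call 7 [Call 4 [Arg 0, Call 3 [Arg 0], Arg 2, Arg 1],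
            Call 4 [Arg 0, Call 3 [Arg 0], Arg 2, Arg 1], Arg 2]"

definition "p_transform =
    Call 13 [Arg 0, Call 12 [Arg 1, Arg 0]]"

definition prog :: program where
  "prog = [p_main, p_lt, p_eq, p_count, p_border, p_blocked, p_inner, p_outer, p_insort, p_sort, p_touch, p_remaining, p_sweep, p_subdivide, p_pieces, p_transform]"

lemma prog_nth:
  "prog ! 0 = p_main"
  "prog ! 1 = p_lt"
  "prog ! 2 = p_eq"
  "prog ! 3 = p_count"
  "prog ! 4 = p_border"
  "prog ! 5 = p_blocked"
  "prog ! 6 = p_inner"
  "prog ! 7 = p_outer"
  "prog ! 8 = p_insort"
  "prog ! 9 = p_sort"
  "prog ! 10 = p_touch"
  "prog ! 11 = p_remaining"
  "prog ! 12 = p_sweep"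
  "prog ! 13 = p_subdivide"
  "prog ! 14 = p_pieces"
  "prog ! 15 = p_transform"
  by (simp_all add: prog_def)

lemma length_prog: "length prog = 16"
  by (simp add: prog_def)

section \<open>Upper bounds on evaluation costs\<close>

definition ev :: "tree list \<Rightarrow> expr \<Rightarrow> tree \<Rightarrow> nat \<Rightarrow> bool" where
  "ev env e v T \<longleftrightarrow> (\<exists>t\<le>T. eval prog env e v t)"

text \<open>Applied first in the cost proofs, it leaves the value and the bound schematic. The
  syntax-directed rules then compute both, and the final method compares them with the claimed ones.
  The numerical constants in the bounds are merely generous.\<close>

lemma ev_weaken: "ev env e v T \<Longrightarrow> v = v' \<Longrightarrow> T \<le> T' \<Longrightarrow> ev env e v' T'"
  by (auto simp: ev_def intro: le_trans)

lemma ev_Arg0: "ev (a # env) (Arg 0) a 1"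
  and ev_Arg1: "ev (a # b # env) (Arg 1) b 1"
  and ev_Arg2: "ev (a # b # c # env) (Arg 2) c 1"
  and ev_Arg3: "ev (a # b # c # d # env) (Arg 3) d 1"
  and ev_Arg4: "ev (a # b # c # d # e # env) (Arg 4) e 1"
  using eval_evals.Arg[of 0 "a # env" prog] eval_evals.Arg[of 1 "a # b # env" prog]
    eval_evals.Arg[of 2 "a # b # c # env" prog] eval_evals.Arg[of 3 "a # b # c # d # env" prog]
    eval_evals.Arg[of 4 "a # b # c # d # e # env" prog]
  unfolding ev_def by (auto simp: numeral_eq_Suc)

lemmas ev_Arg = ev_Arg0 ev_Arg1 ev_Arg2 ev_Arg3 ev_Arg4

lemma ev_MkLeaf: "ev env MkLeaf Leaf 1"
  unfolding ev_def using eval_evals.MkLeaf by blast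

lemma ev_MkNode: "ev env d v S \<Longrightarrow> ev env e w T \<Longrightarrow> ev env (MkNode d e) (Node v w) (S + T + 1)"
  unfolding ev_def by (meson add_mono eval_evals.MkNode order_refl)

lemma ev_LeftOf: "ev env e (Node l r) T \<Longrightarrow> ev env (LeftOf e) l (T + 1)"
  unfolding ev_def by (metis add_mono eval_evals.LeftOf left_child.simps(2) order_refl)

lemma ev_RightOf: "ev env e (Node l r) T \<Longrightarrow> ev env (RightOf e) r (T + 1)"
  unfolding ev_def by (metis add_mono eval_evals.RightOf right_child.simps(2) order_refl)

lemma ev_IfNode:
  "ev env c (Node l r) S \<Longrightarrow> ev env d v T \<Longrightarrow> ev env (IfNode c d e) v (S + T + 1)"
  unfolding ev_def by (meson add_mono eval_evals.IfNode_True order_refl)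

lemma ev_IfLeaf:
  "ev env c Leaf S \<Longrightarrow> ev env e v T \<Longrightarrow> ev env (IfNode c d e) v (S + T + 1)"
  unfolding ev_def by (meson add_mono eval_evals.IfNode_False order_refl)

definition evs :: "tree list \<Rightarrow> expr list \<Rightarrow> tree list \<Rightarrow> nat \<Rightarrow> bool" where
  "evs env es vs T \<longleftrightarrow> (\<exists>t\<le>T. evals prog env es vs t)"

lemma evs_Nil: "evs env [] [] 0"
  by (auto simp: evs_def intro: eval_evals.Nil)

lemma evs_Cons: "ev env e v S \<Longrightarrow> evs env es vs T \<Longrightarrow> evs env (e # es) (v # vs) (S + T)"
  unfolding ev_def evs_def by (meson add_mono eval_evals.Cons)

lemma ev_Call:
  "evs env es vs S \<Longrightarrow> f < 16 \<Longrightarrow> ev vs (prog ! f) v T \<Longrightarrow> ev env (Call f es) v (S + T + 1)"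
  unfolding ev_def evs_def by (metis add_mono eval_evals.Call order_refl length_prog)

lemma ev_Call1:
  "ev env d v S \<Longrightarrow> ev [v] (prog ! f) r T \<Longrightarrow> f < 16 \<Longrightarrow> ev env (Call f [d]) r (S + T + 1)"
  by (rule ev_weaken, (rule ev_Call evs_Cons evs_Nil | assumption)+) auto

lemma ev_Call2:
  "ev env d v S \<Longrightarrow> ev env e w T \<Longrightarrow> ev [v, w] (prog ! f) r U \<Longrightarrow> f < 16 \<Longrightarrow>
    ev env (Call f [d, e]) r (S + T + U + 1)"
  by (rule ev_weaken, (rule ev_Call evs_Cons evs_Nil | assumption)+) auto

lemma ev_e_true: "ev env e_true (encode_bool True) 3"
  unfolding e_true_def encode_bool_def
  by (rule ev_weaken, (rule ev_MkNode ev_MkLeaf)+) auto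

text \<open>Both branches need an evaluation, even the one not taken. Recursion is therefore guarded
  by plain \<open>IfNode\<close>, whose two rules ask only for the branch taken.\<close>

lemma ev_e_cond:
  assumes "ev env c (encode_bool b) S" and "ev env d v T" and "ev env e w U"
  shows "ev env (e_cond c d e) (if b then v else w) (S + max T U + 1)"
proof (cases b)
  case True
  with assms show ?thesis unfolding e_cond_def encode_bool_def
    by (auto intro!: ev_weaken[OF ev_IfNode])
next
  case False
  with assms show ?thesis unfolding e_cond_def encode_bool_def
    by (auto intro!: ev_weaken[OF ev_IfLeaf])
qed

lemma ev_e_and:
  assumes "ev env d (encode_bool a) S" and "ev env e (encode_bool b) T"
  shows "ev env (e_and d e) (encode_bool (a \<and> b)) (S + T + 2)"
  using ev_e_cond[OF assms ev_MkLeaf] unfolding e_cond_def e_and_def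
  by (elim ev_weaken) (auto simp: encode_bool_def)

lemma ev_e_or:
  assumes "ev env d (encode_bool a) S" and "ev env e (encode_bool b) T"
  shows "ev env (e_or d e) (encode_bool (a \<or> b)) (S + T + 4)"
  using ev_e_cond[OF assms(1) ev_e_true assms(2)] unfolding e_cond_def e_or_def
  by (elim ev_weaken) (auto simp: encode_bool_def)

lemma ev_e_not:
  assumes "ev env d (encode_bool a) S"
  shows "ev env (e_not d) (encode_bool (\<not> a)) (S + 4)"
  using ev_e_cond[OF assms(1) ev_MkLeaf ev_e_true] unfolding e_cond_def e_not_def
  by (elim ev_weaken) (auto simp: encode_bool_def)

lemma encode_point_eq: "encode_point p = Node (encode_nat (fst p)) (encode_nat (snd p))"
  by (cases p) (simp add: encode_point_def)

lemma ev_e_co: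
  assumes "ev env (Arg i) (encode_bool b) S" and "ev env e (encode_point p) T"
  shows "ev env (e_co i e) (encode_nat (co b p)) (S + T + 2)"
  using ev_e_cond[OF assms(1) ev_RightOf ev_LeftOf, OF assms(2,2)[unfolded encode_point_eq]]
  unfolding e_cond_def e_co_def
  by (elim ev_weaken) (auto simp: co_def)

lemma ev_e_nco:
  assumes "ev env (Arg i) (encode_bool b) S" and "ev env e (encode_point p) T"
  shows "ev env (e_nco i e) (encode_nat (co (\<not> b) p)) (S + T + 2)"
  using ev_e_cond[OF assms(1) ev_LeftOf ev_RightOf, OF assms(2,2)[unfolded encode_point_eq]]
  unfolding e_cond_def e_nco_def
  by (elim ev_weaken) (auto simp: co_def)

lemma ev_e_mk:
  assumes "ev env (Arg i) (encode_bool b) S" and "ev env d (encode_nat x) T"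
    and "ev env e (encode_nat y) U"
  shows "ev env (e_mk i d e) (encode_point (mk b x y)) (S + T + U + 2)"
  using ev_e_cond[OF assms(1) ev_MkNode[OF assms(3,2)] ev_MkNode[OF assms(2,3)]]
  unfolding e_cond_def e_mk_def
  by (elim ev_weaken) (auto simp: mk_def encode_point_eq)


text \<open>Leaves the evaluation of the body as a premise, so that inside \<open>p_lt\<close>
  itself the induction hypothesis can be supplied.\<close>

lemma ev_e_lt_rec:
  "ev env d (encode_nat a) S \<Longrightarrow> ev env e (encode_nat b) T \<Longrightarrow>
    ev [encode_nat a, encode_nat b] (prog ! 1) r U \<Longrightarrow> ev env (e_lt d e) r (S + T + U + 1)"
  unfolding e_lt_def by (rule ev_Call2) simp_all

lemma eval_lt: "ev [encode_nat a, encode_nat b] (prog ! 1) (encode_bool (a < b)) (20 * a + 20)"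
proof (induction a arbitrary: b)
  case 0
  show ?case
  proof (cases b)
    case 0
    show ?thesis unfolding 0 prog_nth p_lt_def encode_nat.simps
      by (rule ev_weaken, rule ev_IfLeaf, (rule ev_Arg ev_MkLeaf)+, auto simp: encode_bool_def)
  next
    case (Suc c)
    show ?thesis unfolding Suc prog_nth p_lt_def encode_nat.simps
      by (rule ev_weaken, rule ev_IfNode, rule ev_Arg, rule ev_IfLeaf, rule ev_Arg, rule ev_e_true) auto
  qed
next
  case (Suc a)
  show ?case
  proof (cases b)
    case 0
    show ?thesis unfolding 0 prog_nth p_lt_def encode_nat.simps
      by (rule ev_weaken, rule ev_IfLeaf, (rule ev_Arg ev_MkLeaf)+, auto simp: encode_bool_def)
  next
    case (Suc c)
    show ?thesis unfolding Suc prog_nth p_lt_def encode_nat.simps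
      by (rule ev_weaken, rule ev_IfNode, rule ev_Arg, rule ev_IfNode, rule ev_Arg, rule ev_e_lt_rec,
        (rule ev_RightOf ev_Arg Suc.IH)+) auto
  qed
qed

text \<open>The recursion descends in both numbers at once, so the left operand alone bounds its
  cost. The common bound \<open>m\<close> makes the cost independent of the data;
  \<open>ev_e_eq\<close> follows the same scheme.\<close>

lemma ev_e_lt:
  assumes "ev env d (encode_nat a) S" and "ev env e (encode_nat b) T" and "a \<le> m"
  shows "ev env (e_lt d e) (encode_bool (a < b)) (S + T + 20 * m + 21)"
  by (rule ev_weaken[OF ev_e_lt_rec[OF assms(1,2) eval_lt]]) (use assms(3) in auto)

lemma ev_e_eq_rec:
  "ev env d s S \<Longrightarrow> ev env e t T \<Longrightarrow> ev [s, t] (prog ! 2) r U \<Longrightarrow>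
    ev env (e_eq d e) r (S + T + U + 1)"
  unfolding e_eq_def by (rule ev_Call2) simp_all

lemma eval_eq: "ev [s, t] (prog ! 2) (encode_bool (s = t)) (30 * size s + 10)"
proof (induction s arbitrary: t)
  case Leaf
  show ?case
  proof (cases t)
    case Leaf
    show ?thesis unfolding Leaf prog_nth p_eq_def
      by (rule ev_weaken, rule ev_IfLeaf, rule ev_Arg, rule ev_IfLeaf, rule ev_Arg, rule ev_e_true) auto
  next
    case (Node l r)
    show ?thesis unfolding Node prog_nth p_eq_def
      by (rule ev_weaken, rule ev_IfLeaf, rule ev_Arg, rule ev_IfNode, (rule ev_Arg ev_MkLeaf)+)
        (auto simp: encode_bool_def)
  qed
next
  case (Node l r)
  show ?case
  proof (cases t)
    case Leaf
    show ?thesis unfolding Leaf prog_nth p_eq_def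
      by (rule ev_weaken, rule ev_IfNode, rule ev_Arg, rule ev_IfLeaf, (rule ev_Arg ev_MkLeaf)+)
        (auto simp: encode_bool_def)
  next
    case (Node l' r')
    show ?thesis unfolding Node prog_nth p_eq_def
      by (rule ev_weaken, rule ev_IfNode, rule ev_Arg, rule ev_IfNode, rule ev_Arg, rule ev_e_and,
        (rule ev_e_eq_rec ev_LeftOf ev_RightOf ev_Arg Node.IH)+) auto
  qed
qed

lemma ev_e_eq:
  assumes "ev env d s S" and "ev env e t T" and "size s \<le> m"
  shows "ev env (e_eq d e) (encode_bool (s = t)) (S + T + 30 * m + 11)"
  by (rule ev_weaken[OF ev_e_eq_rec[OF assms(1,2) eval_eq]]) (use assms(3) in auto)

lemma encode_nat_inject [simp]: "encode_nat a = encode_nat b \<longleftrightarrow> a = b"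
proof (induction a arbitrary: b)
  case 0 show ?case by (cases b) auto
next
  case (Suc a) then show ?case by (cases b) auto
qed

lemma size_encode_nat [simp]: "size (encode_nat a) = a"
  by (induction a) auto

lemma encode_point_inject [simp]: "encode_point p = encode_point q \<longleftrightarrow> p = q"
  by (simp add: encode_point_eq prod_eq_iff)

lemma encode_seg_eq: "encode_seg s = Node (encode_point (fst s)) (encode_point (snd s))"
  by (cases s) simp

definition small :: "nat \<Rightarrow> point \<Rightarrow> bool" where
  "small m p \<longleftrightarrow> fst p \<le> m \<and> snd p \<le> m"

lemma small_co: "small m p \<Longrightarrow> co b p \<le> m"
  and small_size_co: "small m p \<Longrightarrow> size (encode_nat (co b p)) \<le> m"
  and small_size: "small m p \<Longrightarrow> size (encode_point p) \<le> 2 * m + 1"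
  by (auto simp: small_def co_def encode_point_eq)

section \<open>Costs of the functions of the program\<close>

lemma eval_count:
  "ev [encode_list f xs] (prog ! 3) (encode_nat (Suc (length xs))) (10 * length xs + 10)"
proof (induction xs)
  case Nil
  show ?case unfolding prog_nth p_count_def encode_list.simps
    by (rule ev_weaken, rule ev_IfLeaf, (rule ev_Arg ev_MkNode ev_MkLeaf)+) auto
next
  case (Cons x xs)
  show ?case unfolding prog_nth p_count_def encode_list.simps
    by (rule ev_weaken, rule ev_IfNode, rule ev_Arg, rule ev_MkNode, rule ev_MkLeaf, rule ev_Call1,
      (rule ev_RightOf ev_Arg Cons.IH)+) auto
qed

lemma prog_calls:
  "3 < (16::nat)" "4 < (16::nat)" "5 < (16::nat)" "6 < (16::nat)" "7 < (16::nat)" "8 < (16::nat)"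
  "9 < (16::nat)" "10 < (16::nat)" "11 < (16::nat)" "12 < (16::nat)" "13 < (16::nat)"
  "14 < (16::nat)" "15 < (16::nat)"
  by simp_all

lemmas ev_Calls = ev_Call evs_Cons evs_Nil prog_calls
lemmas ev_intros = ev_Arg ev_LeftOf ev_RightOf ev_e_and ev_e_or ev_e_not ev_e_cond ev_e_lt ev_e_eq
  ev_e_co ev_e_nco ev_e_mk ev_MkNode ev_MkLeaf

lemma eval_border:
  "ev [encode_list encode_point xs, encode_nat N, encode_bool b, encode_list encode_point ys] (prog ! 4)
     (encode_list encode_point (border b N xs ys)) (50 * length xs + 10)"
proof (induction xs)
  case Nil
  show ?case unfolding prog_nth p_border_def encode_list.simps
    by (rule ev_weaken, rule ev_IfLeaf, (rule ev_Arg)+) (auto simp: border_def)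
next
  case (Cons x xs)
  \<comment> \<open>In \<open>p_border\<close> the leaf stands for the coordinate 0, and
    \<open>ev_e_mk\<close> expects its argument in the form \<open>encode_nat\<close>.\<close>
  have leaf: "ev env MkLeaf (encode_nat 0) 1" for env
    by (simp add: ev_MkLeaf[simplified])
  show ?case unfolding prog_nth p_border_def encode_list.simps
    by (rule ev_weaken, rule ev_IfNode, rule ev_Arg, (rule leaf ev_intros ev_Calls Cons.IH)+)
      (auto simp: border_def)
qed

lemma eval_blocked:
  assumes "small m p" and "\<forall>r\<in>set B. small m r"
  shows "ev [encode_list encode_point B, encode_point p, encode_point q, encode_bool b] (prog ! 5)
     (encode_bool (between b (set B) p q)) (Suc (length B) * (100 * m + 200))"
  using assms(2)
proof (induction B)
  case Nil
  show ?case unfolding prog_nth p_blocked_def encode_list.simps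
    by (rule ev_weaken, rule ev_IfLeaf, (rule ev_Arg ev_MkLeaf)+)
      (auto simp: between_def encode_bool_def)
next
  case (Cons r B)
  from Cons.prems have r: "small m r" and B: "\<forall>r\<in>set B. small m r" by auto
  note [simp] = small_co[OF r] small_co[OF assms(1)]
  show ?case unfolding prog_nth p_blocked_def encode_list.simps
    by (rule ev_weaken, rule ev_IfNode, rule ev_Arg,
      (rule ev_intros ev_Calls Cons.IH[OF B] small_co[OF r] small_co[OF assms(1)] small_size_co[OF r])+)
      (auto simp: between_def)
qed

text \<open>The name hides a product of two variables, so that the bounds of the enclosing loops see
  it as an atom. The other \<open>t_\<close> functions serve the same purpose.\<close>

definition t_blocked :: "nat \<Rightarrow> nat \<Rightarrow> nat" where
  "t_blocked m l = Suc l * (100 * m + 200)"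

lemma eval_inner:
  assumes "small m p" and B: "\<forall>r\<in>set B. small m r" and "\<forall>q\<in>set qs. small m q"
  shows "ev [encode_list encode_point qs, encode_point p, encode_list encode_point B, encode_bool b,
       encode_list encode_seg acc] (prog ! 6)
     (encode_list encode_seg
       (filter (\<lambda>(p, q). consecutive b (set B) p q) (map (Pair p) qs) @ acc))
     (Suc (length qs) * (t_blocked m (length B) + 100 * m + 200))"
  using assms(3)
proof (induction qs)
  case Nil
  show ?case unfolding prog_nth p_inner_def encode_list.simps
    by (rule ev_weaken, rule ev_IfLeaf, (rule ev_Arg)+) auto
next
  case (Cons q qs)
  from Cons.prems have q: "small m q" and qs: "\<forall>q\<in>set qs. small m q" by auto
  show ?case unfolding prog_nth p_inner_def encode_list.simps
    by (rule ev_weaken, rule ev_IfNode, rule ev_Arg,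
      (rule ev_intros ev_Calls Cons.IH[OF qs] eval_blocked[OF assms(1) B, folded t_blocked_def]
        small_co[OF q] small_co[OF assms(1)] small_size_co[OF assms(1)])+)
      (auto simp: consecutive_def)
qed

definition t_outer :: "nat \<Rightarrow> nat \<Rightarrow> nat" where
  "t_outer m l = Suc l * (t_blocked m l + 100 * m + 200) + 50"

lemma eval_outer:
  assumes B: "\<forall>r\<in>set B. small m r" and "\<forall>p\<in>set ps. small m p"
  shows "ev [encode_list encode_point ps, encode_list encode_point B, encode_bool b] (prog ! 7)
     (encode_list encode_seg
       (filter (\<lambda>(p, q). consecutive b (set B) p q) (List.product ps B)))
     (Suc (length ps) * t_outer m (length B))"
  using assms(2)
proof (induction ps)
  case Nil
  show ?case unfolding prog_nth p_outer_def encode_list.simps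
    by (rule ev_weaken, rule ev_IfLeaf, (rule ev_Arg ev_MkLeaf)+) (auto simp: t_outer_def)
next
  case (Cons p ps)
  from Cons.prems have p: "small m p" and ps: "\<forall>q\<in>set ps. small m q" by auto
  show ?case unfolding prog_nth p_outer_def encode_list.simps
    by (rule ev_weaken, rule ev_IfNode, rule ev_Arg,
      (rule ev_intros ev_Calls Cons.IH[OF ps] eval_inner[OF p B B])+)
      (auto simp: t_outer_def)
qed

lemma length_border: "length (border b N xs ys) = 2 * length xs + length ys"
  by (induction xs) (auto simp: border_def)

lemma t_outer_mono: "l \<le> l' \<Longrightarrow> t_outer m l \<le> t_outer m l'"
  unfolding t_outer_def t_blocked_def by (intro add_mono mult_mono) auto

definition t_pieces :: "nat \<Rightarrow> nat" where
  "t_pieces m = Suc m * t_outer m m + 120 * m + 100"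

lemma eval_pieces:
  assumes "\<forall>p\<in>set xs. small m p" and "\<forall>p\<in>set ys. small m p"
    and m: "length xs < m" "2 * length xs + length ys \<le> m"
  shows "ev [encode_list encode_point xs, encode_list encode_point ys, encode_bool b] (prog ! 14)
     (encode_list encode_seg (pieces b (border b (Suc (length xs)) xs ys))) (t_pieces m)"
proof -
  let ?B = "border b (Suc (length xs)) xs ys"
  have B: "\<forall>p\<in>set ?B. small m p"
    using assms by (auto simp: border_def mk_def small_def co_def)
  have len: "length ?B \<le> m"
    using m by (simp add: length_border)
  have "Suc (length ?B) * t_outer m (length ?B) \<le> Suc m * t_outer m m"
    using len t_outer_mono[OF len] by (intro mult_le_mono) auto
  then show ?thesis unfolding prog_nth p_pieces_def pieces_def using m
    by - (rule ev_weaken, (rule ev_intros ev_Calls eval_outer[OF B B] eval_border eval_count)+,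
      auto simp: t_pieces_def)
qed

definition small_seg :: "nat \<Rightarrow> segment \<Rightarrow> bool" where
  "small_seg m s \<longleftrightarrow> small m (fst s) \<and> small m (snd s)"

lemma eval_insort:
  assumes g: "small_seg m g" and "\<forall>h\<in>set gs. small_seg m h"
  shows "ev [encode_seg g, encode_list encode_seg gs] (prog ! 8)
    (encode_list encode_seg (insort_key sort_index g gs)) (Suc (length gs) * (100 * m + 200))"
  using assms(2)
proof (induction gs)
  case Nil
  show ?case unfolding prog_nth p_insort_def encode_list.simps
    by (rule ev_weaken, rule ev_IfLeaf, (rule ev_Arg ev_MkLeaf ev_MkNode)+) auto
next
  case (Cons h gs)
  from Cons.prems have h: "small_seg m h" and gs: "\<forall>h\<in>set gs. small_seg m h" by auto
  obtain a b c d where gd: "g = ((a, b), c, d)" by (metis prod.exhaust)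
  obtain a' b' c' d' where hd: "h = ((a', b'), c', d')" by (metis prod.exhaust)
  have le: "a \<le> m" "c \<le> m" "size (encode_nat c) \<le> m"
    using g gd by (auto simp: small_seg_def small_def)
  have enc: "encode_seg g = Node (Node (encode_nat a) (encode_nat b)) (Node (encode_nat c) (encode_nat d))"
    "encode_seg h = Node (Node (encode_nat a') (encode_nat b')) (Node (encode_nat c') (encode_nat d'))"
    by (simp_all add: gd hd encode_point_def)
  note IH = Cons.IH[OF gs, unfolded enc]
  show ?case unfolding prog_nth p_insort_def encode_list.simps enc
    by (rule ev_weaken, rule ev_IfNode, rule ev_Arg, (rule ev_intros ev_Calls IH le)+)
      (auto simp: gd hd encode_point_def sort_index_def)
qed

text \<open>The length bound \<open>l\<close> stays fixed during the induction, so that every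
  insertion is charged the same amount. \<open>eval_remaining\<close> and \<open>eval_sweep\<close>
  use such a bound as well.\<close>

lemma eval_sort:
  assumes "\<forall>h\<in>set gs. small_seg m h" and "length gs \<le> l"
  shows "ev [encode_list encode_seg gs] (prog ! 9)
    (encode_list encode_seg (sort_key sort_index gs)) (Suc (length gs) * (Suc l * (100 * m + 200) + 20))"
  using assms
proof (induction gs)
  case Nil
  show ?case unfolding prog_nth p_sort_def encode_list.simps
    by (rule ev_weaken, rule ev_IfLeaf, (rule ev_Arg ev_MkLeaf ev_MkNode)+) auto
next
  case (Cons g gs)
  from Cons.prems have g: "small_seg m g" and gs: "\<forall>h\<in>set gs. small_seg m h" "length gs \<le> l"
    and gs': "\<forall>h\<in>set (sort_key sort_index gs). small_seg m h" by auto
  show ?case unfolding prog_nth p_sort_def encode_list.simps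
    by (rule ev_weaken, rule ev_IfNode, rule ev_Arg,
      (rule ev_intros ev_Calls Cons.IH[OF gs] eval_insort[OF g gs'])+)
      (use gs(2) in \<open>auto intro!: trans_le_add1 mult_le_mono1\<close>)
qed

lemma touches_eq:
  "touches v h \<longleftrightarrow>
    (fst v = fst h \<or> fst v = snd h) \<or> (snd v = fst h \<or> snd v = snd h)"
  by (auto simp: touches_def endpoints_def)

definition t_touch :: "nat \<Rightarrow> nat \<Rightarrow> nat" where
  "t_touch m l = Suc l * (300 * m + 500)"

lemma eval_touch:
  assumes v: "small_seg m v"
  shows "ev [encode_list encode_seg gs, encode_seg v] (prog ! 10)
    (encode_bool (\<exists>h\<in>set gs. touches v h)) (t_touch m (length gs))"
proof (induction gs)
  case Nil
  show ?case unfolding prog_nth p_touch_def encode_list.simps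
    by (rule ev_weaken, rule ev_IfLeaf, (rule ev_Arg ev_MkLeaf ev_MkNode)+)
      (auto simp: encode_bool_def t_touch_def)
next
  case (Cons h gs)
  have sz: "size (encode_point (fst v)) \<le> 2 * m + 1" "size (encode_point (snd v)) \<le> 2 * m + 1"
    using v by (simp_all only: small_seg_def small_size)
  note IH = Cons.IH[unfolded encode_seg_eq]
  show ?case unfolding prog_nth p_touch_def encode_list.simps encode_seg_eq
    by (rule ev_weaken, rule ev_IfNode, rule ev_Arg, (rule ev_intros ev_Calls IH sz)+)
      (auto simp: touches_eq t_touch_def)
qed

lemma eval_remaining:
  assumes "\<forall>v\<in>set vs. small_seg m v" and "length gs \<le> l"
  shows "ev [encode_list encode_seg vs, encode_list encode_seg gs] (prog ! 11)
    (encode_list encode_seg (filter (\<lambda>v. \<not> (\<exists>h\<in>set gs. touches v h)) vs))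
    (Suc (length vs) * (t_touch m l + 50))"
  using assms(1)
proof (induction vs)
  case Nil
  show ?case unfolding prog_nth p_remaining_def encode_list.simps
    by (rule ev_weaken, rule ev_IfLeaf, (rule ev_Arg ev_MkLeaf)+) auto
next
  case (Cons v vs)
  from Cons.prems have v: "small_seg m v" and vs: "\<forall>v\<in>set vs. small_seg m v" by auto
  have "t_touch m (length gs) \<le> t_touch m l"
    unfolding t_touch_def using assms(2) by (intro mult_right_mono) auto
  then show ?case unfolding prog_nth p_remaining_def encode_list.simps
    by - (rule ev_weaken, rule ev_IfNode, rule ev_Arg,
      (rule ev_intros ev_Calls eval_touch[OF v] Cons.IH[OF vs])+, auto)
qed

abbreviation "encode_step \<equiv> encode_pair encode_seg (encode_list encode_seg)"

definition t_sweep :: "nat \<Rightarrow> nat \<Rightarrow> nat" where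
  "t_sweep m l = Suc l * (t_touch m l + 50) + 50"

lemma eval_sweep:
  assumes vs: "\<forall>v\<in>set vs. small_seg m v" "length vs \<le> l" and "length gs \<le> l"
  shows "ev [encode_list encode_seg gs, encode_list encode_seg vs] (prog ! 12)
    (encode_list encode_step (sweep vs gs)) (Suc (length gs) * t_sweep m l)"
  using assms(3)
proof (induction gs)
  case Nil
  show ?case unfolding prog_nth p_sweep_def encode_list.simps
    by (rule ev_weaken, rule ev_IfLeaf, (rule ev_Arg ev_MkLeaf)+) (auto simp: t_sweep_def)
next
  case (Cons g gs)
  from Cons.prems have gs: "length gs \<le> l" by auto
  have "Suc (length vs) * (t_touch m l + 50) \<le> Suc l * (t_touch m l + 50)"
    using vs(2) by (intro mult_right_mono) auto
  then have *: "Suc (length vs) * (t_touch m l + 50) + 50 \<le> t_sweep m l"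
    unfolding t_sweep_def by linarith
  show ?case unfolding prog_nth p_sweep_def encode_list.simps
    by (rule ev_weaken, rule ev_IfNode, rule ev_Arg,
      (rule ev_intros ev_Calls eval_remaining[OF vs(1) gs] Cons.IH[OF gs])+) (use * in auto)
qed

lemma eval_subdivide:
  "ev [encode_list encode_seg vs, encode_list encode_step st] (prog ! 13)
    (encode_list encode_step (map (\<lambda>v. (v, [])) vs @ st)) (20 * length vs + 20)"
proof (induction vs)
  case Nil
  show ?case unfolding prog_nth p_subdivide_def encode_list.simps
    by (rule ev_weaken, rule ev_IfLeaf, (rule ev_Arg ev_MkLeaf)+) auto
next
  case (Cons v vs)
  show ?case unfolding prog_nth p_subdivide_def encode_list.simps
    by (rule ev_weaken, rule ev_IfNode, rule ev_Arg, (rule ev_intros ev_Calls Cons.IH)+) auto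
qed

text \<open>Pieces are pairs from a border list of length at most \<open>m\<close>, whence
  \<open>m * m\<close> as the bound on their number.\<close>

definition t_main :: "nat \<Rightarrow> nat" where
  "t_main m = 2 * t_pieces m + Suc (m * m) * (Suc (m * m) * (100 * m + 200) + 20) +
     Suc (m * m) * t_sweep m (m * m) + 20 * (m * m) + 200"

lemma encode_steps_eq: "encode_steps = encode_list encode_step"
  by (simp add: encode_steps_def)

text \<open>The length condition in \<open>m\<close> is that of a border list, and
  \<open>length xs < m\<close> makes the margin coordinate \<open>length xs + 1\<close> small
  too.\<close>

lemma eval_main:
  assumes xs: "\<forall>p\<in>set xs. small m p" and ys: "\<forall>p\<in>set ys. small m p"
    and m: "length xs < m" "2 * length xs + length ys \<le> m"
  shows "ev [Node (encode_list encode_point xs) (encode_list encode_point ys)] (prog ! 0)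
    (encode_steps (transform_lists xs ys)) (t_main m)"
proof -
  define S where "S b = pieces b (border b (Suc (length xs)) xs ys)" for b
  have "set (S b) \<subseteq> set (border b (Suc (length xs)) xs ys) \<times> set (border b (Suc (length xs)) xs ys)" for b
    by (auto simp: S_def pieces_def)
  moreover have "\<forall>p\<in>set (border b (Suc (length xs)) xs ys). small m p" for b
    using assms by (auto simp: border_def mk_def small_def co_def)
  ultimately have small: "\<forall>s\<in>set (S b). small_seg m s" for b
    unfolding small_seg_def by (metis (no_types, lifting) mem_Sigma_iff prod.collapse subsetD)
  have len: "length (S b) \<le> m * m" for b
  proof -
    have "length (S b) \<le> length (border b (Suc (length xs)) xs ys) * length (border b (Suc (length xs)) xs ys)"
      unfolding S_def pieces_def by (metis length_filter_le length_product)
    also have "\<dots> \<le> m * m"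
      using m(2) by (intro mult_le_mono) (simp_all add: length_border)
    finally show ?thesis .
  qed
  let ?G = "sort_key sort_index (S True)"
  have lenG: "length ?G \<le> m * m" using len by simp
  have e_sort: "ev [encode_list encode_seg (S True)] (prog ! 9) (encode_list encode_seg ?G)
    (Suc (m * m) * (Suc (m * m) * (100 * m + 200) + 20))"
    by (rule ev_weaken[OF eval_sort[OF small len] refl], rule mult_le_mono1) (simp add: len)
  have e_sweep: "ev [encode_list encode_seg ?G, encode_list encode_seg (S False)] (prog ! 12)
    (encode_list encode_step (sweep (S False) ?G)) (Suc (m * m) * t_sweep m (m * m))"
    by (rule ev_weaken[OF eval_sweep[OF small len lenG] refl], rule mult_le_mono1) (simp add: len)
  note e_pieces = eval_pieces[OF assms, folded S_def]
  \<comment> \<open>The leaf that \<open>p_main\<close> passes to function 14 is the code of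
    \<open>False\<close>, the flag for vertical pieces.\<close>
  have leaf: "ev env MkLeaf (encode_bool False) 1" for env
    by (simp add: encode_bool_def ev_MkLeaf[simplified])
  have result: "encode_steps (transform_lists xs ys) =
    encode_list encode_step (map (\<lambda>v. (v, [])) (S False) @ sweep (S False) ?G)"
    by (simp add: transform_lists_def encode_steps_eq S_def Let_def)
  have e_transform: "ev [encode_list encode_seg (S False), encode_list encode_seg ?G] (prog ! 15)
    (encode_steps (transform_lists xs ys))
    (Suc (m * m) * t_sweep m (m * m) + 20 * (m * m) + 50)"
    unfolding result prog_nth p_transform_def
    by (rule ev_weaken, (rule ev_intros ev_Calls eval_subdivide e_sweep)+)
      (use len[of False] in auto)
  show ?thesis unfolding prog_nth(1) p_main_def
    by (rule ev_weaken, (rule ev_Calls ev_LeftOf ev_RightOf ev_Arg leaf ev_e_true e_pieces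
      e_sort e_transform)+) (auto simp: t_main_def)
qed

section \<open>Polynomial bounds\<close>

definition poly_bounded :: "(nat \<Rightarrow> nat) \<Rightarrow> bool" where
  "poly_bounded f \<longleftrightarrow> (\<exists>c k. \<forall>s. f s \<le> c * Suc s ^ k)"

lemma poly_bounded_const: "poly_bounded (\<lambda>s. c)"
  unfolding poly_bounded_def by (rule exI[of _ c], rule exI[of _ 0]) simp

lemma poly_bounded_id: "poly_bounded (\<lambda>s. s)"
  unfolding poly_bounded_def by (rule exI[of _ 1], rule exI[of _ 1]) simp

text \<open>The base \<open>Suc s\<close> is positive even for \<open>s = 0\<close>, so passing to
  the larger exponent \<open>k + j\<close> never decreases a term.\<close>

lemma poly_bounded_add:
  assumes "poly_bounded f" and "poly_bounded g"
  shows "poly_bounded (\<lambda>s. f s + g s)"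
proof -
  obtain c k d j where f: "\<And>s. f s \<le> c * Suc s ^ k" and g: "\<And>s. g s \<le> d * Suc s ^ j"
    using assms unfolding poly_bounded_def by blast
  have "f s + g s \<le> (c + d) * Suc s ^ (k + j)" for s
  proof -
    have "c * Suc s ^ k \<le> c * Suc s ^ (k + j)" "d * Suc s ^ j \<le> d * Suc s ^ (k + j)"
      by (intro mult_left_mono power_increasing; simp)+
    with f[of s] g[of s] show ?thesis unfolding add_mult_distrib by linarith
  qed
  then show ?thesis unfolding poly_bounded_def by blast
qed

lemma poly_bounded_mult:
  assumes "poly_bounded f" and "poly_bounded g"
  shows "poly_bounded (\<lambda>s. f s * g s)"
proof -
  obtain c k d j where f: "\<And>s. f s \<le> c * Suc s ^ k" and g: "\<And>s. g s \<le> d * Suc s ^ j"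
    using assms unfolding poly_bounded_def by blast
  have "f s * g s \<le> (c * d) * Suc s ^ (k + j)" for s
    using mult_le_mono[OF f g, of s s] by (simp add: power_add mult_ac)
  then show ?thesis unfolding poly_bounded_def by blast
qed

lemma poly_bounded_Suc: "poly_bounded f \<Longrightarrow> poly_bounded (\<lambda>s. Suc (f s))"
  using poly_bounded_add[OF poly_bounded_const[of 1]] by simp

lemmas poly_bounded_intros =
  poly_bounded_Suc poly_bounded_add poly_bounded_mult poly_bounded_id poly_bounded_const

text \<open>For positive \<open>s\<close> the estimate \<open>Suc s \<le> 2 * s\<close> costs a
  factor \<open>2 ^ k\<close>; the additive constant takes care of \<open>s = 0\<close>.\<close>

lemma poly_bounded_power_form:
  assumes "poly_bounded f"
  obtains c k where "\<And>s. f s \<le> c * s ^ k + c"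
proof -
  obtain c k where f: "\<And>s. f s \<le> c * Suc s ^ k"
    using assms unfolding poly_bounded_def by blast
  have "f s \<le> (c * 2 ^ k) * s ^ k + c * 2 ^ k" for s
  proof (cases "s = 0")
    case True
    have "f 0 \<le> c * 1" using f[of 0] by simp
    also have "\<dots> \<le> c * 2 ^ k" by (rule mult_left_mono) simp_all
    finally show ?thesis unfolding True by (rule trans_le_add2)
  next
    case False
    then have "Suc s ^ k \<le> (2 * s) ^ k" by (intro power_mono) auto
    then have "c * Suc s ^ k \<le> c * (2 * s) ^ k" by (rule mult_left_mono) simp
    also have "\<dots> = (c * 2 ^ k) * s ^ k" by (simp add: power_mult_distrib)
    finally show ?thesis using f[of s] by linarith
  qed
  with that show thesis by blast
qed

text \<open>For an input code of size \<open>s\<close>, the number \<open>3 * s + 2\<close>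
  dominates the coordinates and the lengths of the border lists. The final 2 pays for the initial
  call and its argument.\<close>

lemma poly_bounded_t_main: "poly_bounded (\<lambda>s. t_main (3 * s + 2) + 2)"
  unfolding t_main_def t_pieces_def t_outer_def t_blocked_def t_sweep_def t_touch_def
  by (intro poly_bounded_intros)

lemma size_encode_list: "length xs \<le> size (encode_list f xs)"
  by (induction xs) auto

lemma perm_point_setE:
  assumes "perm_point_set X"
  obtains x where "x permutes {1..card X}" and "X = (\<lambda>i. (x i, i)) ` {1..card X}"
proof -
  obtain n x where x: "x permutes {1..n}" "X = (\<lambda>i. (x i, i)) ` {1..n}"
    using assms unfolding perm_point_set_def by blast
  have "card X = n" unfolding x(2) by (subst card_image) (auto simp: inj_on_def)
  with x show thesis by (intro that[of x]) simp_all
qed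

lemma perm_point_set_subset:
  assumes "perm_point_set X"
  shows "X \<subseteq> {1..card X} \<times> {1..card X}"
proof -
  obtain x where x: "x permutes {1..card X}" and X: "X = (\<lambda>i. (x i, i)) ` {1..card X}"
    using assms by (rule perm_point_setE)
  show ?thesis
  proof
    fix p assume "p \<in> X"
    then obtain i where "i \<in> {1..card X}" "p = (x i, i)" by (subst (asm) X) blast
    then show "p \<in> {1..card X} \<times> {1..card X}" using permutes_in_image[OF x, of i] by auto
  qed
qed

text \<open>Coordinates are at most \<open>card X\<close>, and the code has at least one inner node
  per point, so the input size bounds coordinates and list lengths alike.\<close>

lemma polytime_transform:
  "polytime_on {(X, Y). perm_point_set X \<and> superset_solution X Y}
     (encode_pair encode_points encode_points) encode_steps transform"
proof -
  obtain c k where bound: "\<And>s. t_main (3 * s + 2) + 2 \<le> c * s ^ k + c"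
    using poly_bounded_power_form[OF poly_bounded_t_main] by blast
  have "\<exists>t \<le> c * size (encode_pair encode_points encode_points (X, Y)) ^ k + c.
      eval prog [encode_pair encode_points encode_points (X, Y)] (Call 0 [Arg 0])
        (encode_steps (transform (X, Y))) t"
    if X: "perm_point_set X" and Y: "superset_solution X Y" for X Y
  proof -
    let ?xs = "sorted_list_of_set X" and ?ys = "sorted_list_of_set Y"
    let ?s = "size (encode_pair encode_points encode_points (X, Y))"
    have XY: "X \<subseteq> {1..card X} \<times> {1..card X}" "Y \<subseteq> {1..card X} \<times> {1..card X}"
      using perm_point_set_subset[OF X] Y by (auto simp: superset_solution_def)
    then have fin: "finite X" "finite Y" by (auto intro: finite_subset)
    have len: "length ?xs + length ?ys \<le> ?s"
      using size_encode_list[of ?xs encode_point] size_encode_list[of ?ys encode_point]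
      by (simp add: encode_points_def)
    moreover have "length ?xs = card X" by simp
    ultimately have "card X \<le> ?s" by linarith
    then have small: "small (3 * ?s + 2) p" if "p \<in> X \<union> Y" for p
      using XY that unfolding small_def by fastforce
    have "ev [Node (encode_list encode_point ?xs) (encode_list encode_point ?ys)] (prog ! 0)
      (encode_steps (transform_lists ?xs ?ys)) (t_main (3 * ?s + 2))"
      by (rule eval_main) (use len small fin in auto)
    then have "ev [encode_pair encode_points encode_points (X, Y)] (Call 0 [Arg 0])
      (encode_steps (transform (X, Y))) (t_main (3 * ?s + 2) + 2)"
      by - (rule ev_weaken, rule ev_Call1, rule ev_Arg, assumption?,
        auto simp: transform_def encode_points_def)
    then show ?thesis unfolding ev_def using bound[of ?s] order.trans by blast
  qed
  then show ?thesis unfolding polytime_on_def by blast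
qed

section \<open>Valid states and flips\<close>

definition framed :: "nat \<Rightarrow> point set \<Rightarrow> bool" where
  "framed n P \<longleftrightarrow> margin n \<subseteq> P \<and> P \<subseteq> non_margin n \<union> margin n"

text \<open>The condition on \<open>co b p\<close> leaves out the frame lines, on which margin
  points are neighbours of each other as well.\<close>

definition links :: "bool \<Rightarrow> nat \<Rightarrow> point set \<Rightarrow> segment set" where
  "links b n P = {(p, q). p \<in> P \<and> q \<in> P \<and> co b p \<in> {1..n} \<and> consecutive b P p q}"

lemma point_eqI: "co b p = co b q \<Longrightarrow> co (\<not> b) p = co (\<not> b) q \<Longrightarrow> p = q"
  by (cases b) (auto simp: co_def prod_eq_iff)

lemma co_mk [simp]: "co b (mk b u w) = u" "co (\<not> b) (mk b u w) = w"
  by (auto simp: co_def mk_def)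

lemma margin_iff:
  "p \<in> margin n \<longleftrightarrow>
    (fst p \<in> {1..n} \<and> snd p \<in> {0, n + 1}) \<or> (snd p \<in> {1..n} \<and> fst p \<in> {0, n + 1})"
  by (cases p) (auto simp: margin_def)

lemma in_margin: "co b p \<in> {1..n} \<Longrightarrow> co (\<not> b) p \<in> {0, n + 1} \<Longrightarrow> p \<in> margin n"
  by (cases b) (auto simp: co_def margin_iff)

lemma framed_cases: "framed n P \<Longrightarrow> p \<in> P \<Longrightarrow> p \<in> non_margin n \<or> p \<in> margin n"
  unfolding framed_def by blast

lemma framed_le: "framed n P \<Longrightarrow> p \<in> P \<Longrightarrow> co b p \<le> n + 1"
  using framed_cases[of n P p] by (auto simp: co_def margin_iff non_margin_def)

lemma framed_finite:
  assumes "framed n P" shows "finite P"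
proof (rule finite_subset)
  show "P \<subseteq> {..n + 1} \<times> {..n + 1}"
    using framed_le[OF assms, of _ True] framed_le[OF assms, of _ False]
    by (auto simp: co_def mem_Times_iff)
qed simp

lemma framed_grid:
  assumes "framed n P"
  shows "P \<subseteq> grid n - corners n"
proof
  fix p assume "p \<in> P"
  then show "p \<in> grid n - corners n"
    using framed_cases[OF assms, of p]
    by (cases p) (auto simp: margin_iff non_margin_def grid_def corners_def)
qed

lemma exists_max_on:
  fixes f :: "'a \<Rightarrow> nat"
  assumes "finite A" and "A \<noteq> {}"
  shows "\<exists>p\<in>A. \<forall>r\<in>A. f r \<le> f p"
proof -
  have "Max (f ` A) \<in> f ` A" using assms by (intro Max_in) simp_all
  then obtain p where "p \<in> A" "Max (f ` A) = f p" by (rule imageE)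
  moreover have "\<forall>r\<in>A. f r \<le> Max (f ` A)" using assms by simp
  ultimately show ?thesis by auto
qed

lemma exists_min_on:
  fixes f :: "'a \<Rightarrow> nat"
  assumes "finite A" and "A \<noteq> {}"
  shows "\<exists>p\<in>A. \<forall>r\<in>A. f p \<le> f r"
proof -
  have "Min (f ` A) \<in> f ` A" using assms by (intro Min_in) simp_all
  then obtain p where "p \<in> A" "Min (f ` A) = f p" by (rule imageE)
  moreover have "\<forall>r\<in>A. Min (f ` A) \<le> f r" using assms by simp
  ultimately show ?thesis by auto
qed

text \<open>The margin supplies a point of \<open>P\<close> at or before \<open>z\<close> and one
  beyond it; the nearest ones form the link. The range is half-open, so that \<open>z\<close> may be
  a point of \<open>P\<close>, namely the start of the link.\<close>

lemma link_over:
  assumes P: "framed n P" and "co b z \<in> {1..n}" and "co (\<not> b) z \<le> n"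
  obtains p q where "(p, q) \<in> links b n P" and "co b p = co b z"
    and "co (\<not> b) p \<le> co (\<not> b) z" and "co (\<not> b) z < co (\<not> b) q"
proof -
  let ?A = "{r \<in> P. co b r = co b z \<and> co (\<not> b) r \<le> co (\<not> b) z}"
  let ?B = "{r \<in> P. co b r = co b z \<and> co (\<not> b) z < co (\<not> b) r}"
  have "mk b (co b z) 0 \<in> margin n" "mk b (co b z) (n + 1) \<in> margin n"
    using assms(2) by (auto intro!: in_margin[of b])
  then have "mk b (co b z) 0 \<in> ?A" "mk b (co b z) (n + 1) \<in> ?B"
    using P assms(3) by (auto simp: framed_def)
  then have "?A \<noteq> {}" "?B \<noteq> {}" by blast+
  moreover have "finite ?A" "finite ?B" using framed_finite[OF P] by auto
  ultimately obtain p q where p: "p \<in> ?A" "\<forall>r\<in>?A. co (\<not> b) r \<le> co (\<not> b) p"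
    and q: "q \<in> ?B" "\<forall>r\<in>?B. co (\<not> b) q \<le> co (\<not> b) r"
    using exists_max_on[of ?A "co (\<not> b)"] exists_min_on[of ?B "co (\<not> b)"] by blast
  have pq: "p \<in> P" "q \<in> P" "co b p = co b z" "co b q = co b z"
    "co (\<not> b) p \<le> co (\<not> b) z" "co (\<not> b) z < co (\<not> b) q"
    using p(1) q(1) by simp_all
  have "\<not> (co (\<not> b) p < co (\<not> b) r \<and> co (\<not> b) r < co (\<not> b) q)"
    if "r \<in> P" "co b r = co b p" for r
    using that p(2)[rule_format, of r] q(2)[rule_format, of r] pq
    by (cases "co (\<not> b) r \<le> co (\<not> b) z") simp_all
  then have "\<not> between b P p q" unfolding between_def by blast
  then show thesis using pq assms(2)
    by (intro that[of p q]) (simp_all add: links_def consecutive_def)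
qed

lemma link_before:
  assumes P: "framed n P" and p: "p \<in> P" "co b p \<in> {1..n}" "0 < co (\<not> b) p"
  obtains q where "(q, p) \<in> links b n P"
proof -
  have "co (\<not> b) p \<le> n + 1" using framed_le[OF P p(1)] .
  \<comment> \<open>One lattice position before \<open>p\<close>: the link over \<open>z\<close>
    ends at the first point of \<open>P\<close> beyond \<open>z\<close>, which is
    \<open>p\<close>.\<close>
  moreover define z where "z = mk b (co b p) (co (\<not> b) p - 1)"
  then have z: "co b z = co b p" "co (\<not> b) z = co (\<not> b) p - 1" by simp_all
  ultimately have "co b z \<in> {1..n}" "co (\<not> b) z \<le> n" using p(2) by auto
  then obtain q r where "(q, r) \<in> links b n P" "co b q = co b z"
    "co (\<not> b) q \<le> co (\<not> b) z" "co (\<not> b) z < co (\<not> b) r"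
    by (rule link_over[OF P])
  note qr = this[unfolded z]
  have "co (\<not> b) q < co (\<not> b) p" "co b r = co b p" "\<not> co (\<not> b) p < co (\<not> b) r"
    using qr p by (auto simp: links_def consecutive_def between_def)
  with qr have "r = p" by (intro point_eqI[of b]) auto
  with qr that show thesis by blast
qed

lemma link_after:
  assumes P: "framed n P" and p: "p \<in> P" "co b p \<in> {1..n}" "co (\<not> b) p \<le> n"
  obtains q where "(p, q) \<in> links b n P"
proof -
  obtain q r where qr: "(q, r) \<in> links b n P" "co b q = co b p"
    "co (\<not> b) q \<le> co (\<not> b) p" "co (\<not> b) p < co (\<not> b) r"
    using link_over[OF P, of b p] p by blast
  then have "\<not> co (\<not> b) q < co (\<not> b) p"
    using p by (auto simp: links_def consecutive_def between_def)
  with qr have "q = p" by (intro point_eqI[of b]) auto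
  with qr that show thesis by blast
qed

lemma links_orientation:
  "s \<in> links True n P \<Longrightarrow> horizontal s" "s \<in> links False n P \<Longrightarrow> vertical s"
  by (auto simp: links_def consecutive_def horizontal_def vertical_def co_def)

lemma horizontal_not_vertical: "horizontal s \<Longrightarrow> \<not> vertical s"
  by (auto simp: horizontal_def vertical_def)

lemma mem_seg_points:
  assumes "co b p = co b q" and "co (\<not> b) p \<le> co (\<not> b) q"
  shows "r \<in> seg_points (p, q) \<longleftrightarrow>
    co b r = co b p \<and> co (\<not> b) p \<le> co (\<not> b) r \<and> co (\<not> b) r \<le> co (\<not> b) q"
  using assms by (cases b) (auto simp: seg_points_def rectangle_def co_def mem_Times_iff)

lemma links_seg_points:
  assumes "(p, q) \<in> links b n P"
  shows "r \<in> seg_points (p, q) \<longleftrightarrow>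
    co b r = co b p \<and> co (\<not> b) p \<le> co (\<not> b) r \<and> co (\<not> b) r \<le> co (\<not> b) q"
  using assms by (intro mem_seg_points) (auto simp: links_def consecutive_def)

lemma links_D:
  assumes "(p, q) \<in> links b n P"
  shows "p \<in> P" "q \<in> P" "co b p \<in> {1..n}" "co b q = co b p" "co (\<not> b) p < co (\<not> b) q"
    and "\<And>r. r \<in> P \<Longrightarrow> co b r = co b p \<Longrightarrow> co (\<not> b) r \<le> co (\<not> b) p \<or> co (\<not> b) q \<le> co (\<not> b) r"
  using assms by (fastforce simp: links_def consecutive_def between_def)+

lemma links_endpoints:
  assumes "s \<in> links b n P"
  shows "seg_points s \<inter> P = endpoints s"
proof -
  obtain p q where s: "s = (p, q)" by (metis prod.exhaust)
  note D = links_D[OF assms[unfolded s]] and S = links_seg_points[OF assms[unfolded s]]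
  have "r = p \<or> r = q" if "r \<in> seg_points s" "r \<in> P" for r
    using that D(4-6) unfolding s S by (metis le_antisym point_eqI)
  moreover have "p \<in> seg_points s" "q \<in> seg_points s" unfolding s S using D(4,5) by auto
  ultimately show ?thesis using D(1,2) unfolding s endpoints_def fst_conv snd_conv by blast
qed

text \<open>A common point puts both links on one line. There the link that starts earlier must end
  before or at the start of the other, and two links with the same start coincide.\<close>

lemma links_inter:
  assumes "s \<in> links b n P" and "t \<in> links b n P" and "s \<noteq> t"
  shows "seg_points s \<inter> seg_points t \<subseteq> endpoints s \<inter> endpoints t"
proof
  fix r assume r: "r \<in> seg_points s \<inter> seg_points t"
  obtain p q p' q' where s: "s = (p, q)" and t: "t = (p', q')" by (metis prod.exhaust)
  note D = links_D[OF assms(1)[unfolded s]] and S = links_seg_points[OF assms(1)[unfolded s]]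
  note D' = links_D[OF assms(2)[unfolded t]] and S' = links_seg_points[OF assms(2)[unfolded t]]
  have r: "co b r = co b p" "co b r = co b p'" "co (\<not> b) p \<le> co (\<not> b) r" "co (\<not> b) r \<le> co (\<not> b) q"
    "co (\<not> b) p' \<le> co (\<not> b) r" "co (\<not> b) r \<le> co (\<not> b) q'"
    using r unfolding s t using S S' by auto
  consider "co (\<not> b) p < co (\<not> b) p'" | "co (\<not> b) p' < co (\<not> b) p" | "co (\<not> b) p = co (\<not> b) p'" by linarith
  then show "r \<in> endpoints s \<inter> endpoints t"
  proof cases
    case 1
    then have "co (\<not> b) q \<le> co (\<not> b) p'" using D(6)[OF D'(1)] r by auto
    then have "r = q" "r = p'" using r D(4) by (intro point_eqI[of b]; simp)+
    then show ?thesis by (auto simp: s t endpoints_def)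
  next
    case 2
    then have "co (\<not> b) q' \<le> co (\<not> b) p" using D'(6)[OF D(1)] r by auto
    then have "r = q'" "r = p" using r D'(4) by (intro point_eqI[of b]; simp)+
    then show ?thesis by (auto simp: s t endpoints_def)
  next
    case 3
    then have p: "p = p'" using r by (intro point_eqI[of b]) simp_all
    have "co (\<not> b) q \<le> co (\<not> b) q'" "co (\<not> b) q' \<le> co (\<not> b) q"
      using D(6)[OF D'(2)] D'(6)[OF D(2)] D(4,5) D'(4,5) p by simp_all
    then have "q = q'" using D(4) D'(4) p by (intro point_eqI[of b]) simp_all
    with p assms(3) s t show ?thesis by simp
  qed
qed

text \<open>Strict inequalities suffice, since \<open>links_endpoints\<close> already keeps the end
  of one link out of the interior of another.\<close>

definition crosses :: "segment \<Rightarrow> segment \<Rightarrow> bool" where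
  "crosses g v \<longleftrightarrow>
     fst (fst g) < fst (fst v) \<and> fst (fst v) < fst (snd g) \<and>
     snd (fst v) < snd (fst g) \<and> snd (fst g) < snd (snd v)"

text \<open>A common point in \<open>P\<close> is an endpoint of both links by
  \<open>links_endpoints\<close>; a common point outside \<open>P\<close> is interior to both and
  hence a crossing.\<close>

lemma links_inter_perpendicular:
  assumes P: "framed n P" and g: "g \<in> links True n P" and v: "v \<in> links False n P" and "\<not> crosses g v"
  shows "seg_points g \<inter> seg_points v \<subseteq> endpoints g \<inter> endpoints v"
proof
  fix r assume "r \<in> seg_points g \<inter> seg_points v"
  then have r: "r \<in> seg_points g" "r \<in> seg_points v" by auto
  obtain a b c d where gv: "g = (a, b)" "v = (c, d)" by (metis prod.exhaust)
  have "r \<in> P"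
  proof (rule ccontr)
    assume "r \<notin> P"
    then have ne: "r \<noteq> a" "r \<noteq> b" "r \<noteq> c" "r \<noteq> d" using g v links_D(1,2) unfolding gv by blast+
    have ab: "snd b = snd a" "snd r = snd a" "fst a \<le> fst r" "fst r \<le> fst b"
      using r(1) g links_seg_points[of a b True n P r] links_D(4)[of a b True n P]
      unfolding gv co_def by simp_all
    have cd: "fst d = fst c" "fst r = fst c" "snd c \<le> snd r" "snd r \<le> snd d"
      using r(2) v links_seg_points[of c d False n P r] links_D(4)[of c d False n P]
      unfolding gv co_def by simp_all
    have "fst a < fst r" "fst r < fst b" "snd c < snd r" "snd r < snd d"
      using ab cd ne by (simp_all add: prod_eq_iff order.strict_iff_order)
    then show False using assms(4) ab cd unfolding gv crosses_def by simp
  qed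
  with r show "r \<in> endpoints g \<inter> endpoints v"
    using links_endpoints[OF g] links_endpoints[OF v] by blast
qed

text \<open>Reduces validity to two combinatorial conditions. Every inner point has a link on either
  side in both orientations, so having all links of one orientation gives two parallel segments at
  the point.\<close>

lemma valid_state_links:
  assumes P: "framed n P" and D: "D \<subseteq> links True n P" and W: "W \<subseteq> links False n P"
    and cross: "\<And>g v. g \<in> D \<Longrightarrow> v \<in> W \<Longrightarrow> \<not> crosses g v"
    and elbow: "\<And>p. p \<in> P \<inter> non_margin n \<Longrightarrow>
      (\<forall>v\<in>links False n P. p \<in> endpoints v \<longrightarrow> v \<in> W) \<or>
      (\<forall>g\<in>links True n P. p \<in> endpoints g \<longrightarrow> g \<in> D)"
  shows "valid_state n (P, D \<union> W)"
proof -
  have ends: "seg_points s \<inter> P = endpoints s" if "s \<in> D \<union> W" for s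
    using that D W links_endpoints by blast
  have inter: "seg_points s \<inter> seg_points t \<subseteq> endpoints s \<inter> endpoints t"
    if st: "s \<in> D \<union> W" "t \<in> D \<union> W" "s \<noteq> t" for s t
  proof -
    consider "s \<in> D" "t \<in> D" | "s \<in> W" "t \<in> W" | "s \<in> D" "t \<in> W" | "s \<in> W" "t \<in> D"
      using st by blast
    then show ?thesis
    proof cases
      case 1
      then show ?thesis using links_inter[of s True n P t] D st(3) by blast
    next
      case 2
      then show ?thesis using links_inter[of s False n P t] W st(3) by blast
    next
      case 3
      then show ?thesis using links_inter_perpendicular[OF P, of s t] cross[of s t] D W by blast
    next
      case 4
      then show ?thesis using links_inter_perpendicular[OF P, of t s] cross[of t s] D W by blast
    qed
  qed
  have deg: "2 \<le> card I \<and> (card I = 2 \<longrightarrow> (\<forall>s\<in>I. horizontal s) \<or> (\<forall>s\<in>I. vertical s))"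
    if p: "p \<in> P \<inter> non_margin n" and I: "I = {s \<in> D \<union> W. p \<in> seg_points s}" for p I
  proof -
    have "D \<union> W \<subseteq> P \<times> P" using D W by (auto simp: links_def)
    then have "I \<subseteq> P \<times> P" unfolding I by blast
    then have fin: "finite I"
      by (rule finite_subset) (use framed_finite[OF P] in simp)
    have co: "co b p \<in> {1..n}" for b
      using p by (auto simp: non_margin_def co_def)
    have two: "\<exists>q r. (q, p) \<in> links b n P \<and> (p, r) \<in> links b n P" for b
    proof -
      have *: "p \<in> P" "0 < co (\<not> b) p" "co (\<not> b) p \<le> n" using p co[of "\<not> b"] by simp_all
      obtain q where "(q, p) \<in> links b n P" using link_before[OF P *(1) co *(2)] .
      moreover obtain r where "(p, r) \<in> links b n P" using link_after[OF P *(1) co *(3)] .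
      ultimately show ?thesis by blast
    qed
    have "\<exists>s t. s \<noteq> t \<and> {s, t} \<subseteq> I \<and> (horizontal s \<and> horizontal t \<or> vertical s \<and> vertical t)"
      using elbow[OF p]
    proof
      assume all: "\<forall>v\<in>links False n P. p \<in> endpoints v \<longrightarrow> v \<in> W"
      obtain q r where qr: "(q, p) \<in> links False n P" "(p, r) \<in> links False n P" using two by blast
      then have "(q, p) \<in> W" "(p, r) \<in> W" using all by (auto simp: endpoints_def)
      moreover have "(q, p) \<noteq> (p, r)" using links_D(5)[OF qr(1)] by auto
      moreover have "p \<in> seg_points (q, p)" "p \<in> seg_points (p, r)"
        by (simp_all add: seg_points_def rectangle_def mem_Times_iff)
      moreover note links_orientation(2)[OF qr(1)] links_orientation(2)[OF qr(2)]
      ultimately show ?thesis unfolding I by blast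
    next
      assume all: "\<forall>v\<in>links True n P. p \<in> endpoints v \<longrightarrow> v \<in> D"
      obtain q r where qr: "(q, p) \<in> links True n P" "(p, r) \<in> links True n P" using two by blast
      then have "(q, p) \<in> D" "(p, r) \<in> D" using all by (auto simp: endpoints_def)
      moreover have "(q, p) \<noteq> (p, r)" using links_D(5)[OF qr(1)] by auto
      moreover have "p \<in> seg_points (q, p)" "p \<in> seg_points (p, r)"
        by (simp_all add: seg_points_def rectangle_def mem_Times_iff)
      moreover note links_orientation(1)[OF qr(1)] links_orientation(1)[OF qr(2)]
      ultimately show ?thesis unfolding I by blast
    qed
    then obtain s t where st: "s \<noteq> t" "{s, t} \<subseteq> I"
      "horizontal s \<and> horizontal t \<or> vertical s \<and> vertical t" by blast
    \<comment> \<open>If exactly two segments meet at \<open>p\<close>, they are the parallel pair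
      just found.\<close>
    have "card {s, t} = 2" using st(1) by simp
    then have "2 \<le> card I" "card I = 2 \<longrightarrow> I = {s, t}"
      using card_mono[OF fin st(2)] card_subset_eq[OF fin st(2)] by auto
    with st(3) show ?thesis by auto
  qed
  have "\<forall>s\<in>D \<union> W. (horizontal s \<or> vertical s) \<and> endpoints s \<subseteq> P"
    using D W links_orientation ends by blast
  moreover have "\<forall>s\<in>D \<union> W. seg_points s \<inter> P = endpoints s" using ends by blast
  moreover have "\<forall>s\<in>D \<union> W. \<forall>t\<in>D \<union> W. s \<noteq> t \<longrightarrow>
    seg_points s \<inter> seg_points t \<subseteq> endpoints s \<inter> endpoints t" using inter by blast
  moreover have "\<forall>p \<in> P \<inter> non_margin n. let I = {s \<in> D \<union> W. p \<in> seg_points s} in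
      2 \<le> card I \<and> (card I = 2 \<longrightarrow> (\<forall>s\<in>I. horizontal s) \<or> (\<forall>s\<in>I. vertical s))"
    unfolding Let_def by (rule ballI) (rule deg[OF _ refl])
  ultimately show ?thesis
    unfolding valid_state_def prod.case using framed_grid[OF P] by - (intro conjI; assumption)
qed

section \<open>Satisfied sets and the order of the horizontal pieces\<close>

lemma between_nat:
  fixes a b c r :: nat
  assumes "min a c \<le> r" and "r \<le> max a c"
  shows "max a r - min a r \<le> max a c - min a c"
    and "max a r - min a r = max a c - min a c \<Longrightarrow> r = c"
    and "min a b \<le> c \<Longrightarrow> c \<le> max a b \<Longrightarrow> min a b \<le> r \<and> r \<le> max a b"
  using assms by linarith+

lemma mem_rectangle:
  "r \<in> rectangle a b \<longleftrightarrow> min (fst a) (fst b) \<le> fst r \<and> fst r \<le> max (fst a) (fst b) \<and>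
    min (snd a) (snd b) \<le> snd r \<and> snd r \<le> max (snd a) (snd b)"
  by (simp add: rectangle_def mem_Times_iff)

text \<open>Take the point of the rectangle closest to \<open>a\<close>, apart from
  \<open>a\<close>. If it were not aligned with \<open>a\<close>, satisfaction would give another
  point in the smaller rectangle spanned by the two, and that one would be closer.\<close>

lemma exists_aligned_in_rectangle:
  assumes Y: "satisfied Y" and "finite Y" and a: "a \<in> Y" and b: "b \<in> Y" "b \<noteq> a"
  obtains c where "c \<in> Y" "c \<in> rectangle a b" "c \<noteq> a" "fst c = fst a \<or> snd c = snd a"
proof -
  let ?A = "{c \<in> Y. c \<in> rectangle a b \<and> c \<noteq> a}"
  \<comment> \<open>The distance on \<open>nat\<close>, free of truncated subtraction;
    \<open>d\<close> below is the L1 distance from \<open>a\<close>.\<close>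
  define e :: "nat \<Rightarrow> nat \<Rightarrow> nat" where "e x y = max x y - min x y" for x y
  define d where "d c = e (fst a) (fst c) + e (snd a) (snd c)" for c
  have "b \<in> ?A" using b by (simp add: mem_rectangle)
  then have "?A \<noteq> {}" by blast
  moreover have "finite ?A" using assms(2) by simp
  ultimately obtain c where c: "c \<in> ?A" and min: "\<And>r. r \<in> ?A \<Longrightarrow> d c \<le> d r"
    using exists_min_on[of ?A d] by blast
  have "fst c = fst a \<or> snd c = snd a"
  proof (rule ccontr)
    assume "\<not> (fst c = fst a \<or> snd c = snd a)"
    then obtain r where r: "r \<in> Y" "r \<noteq> a" "r \<noteq> c" "r \<in> rectangle a c"
      using Y a c unfolding satisfied_def by (metis (no_types, lifting) DiffE insertCI mem_Collect_eq)
    note fst_r = between_nat[of "fst a" "fst c" "fst r", folded e_def]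
      and snd_r = between_nat[of "snd a" "snd c" "snd r", folded e_def]
    have "r \<in> ?A" using r c fst_r(3)[of "fst b"] snd_r(3)[of "snd b"] by (simp add: mem_rectangle)
    then have "d c \<le> d r" by (rule min)
    moreover have "e (fst a) (fst r) \<le> e (fst a) (fst c)" "e (snd a) (snd r) \<le> e (snd a) (snd c)"
      using r(4) fst_r(1) snd_r(1) unfolding mem_rectangle by blast+
    ultimately have "e (fst a) (fst r) = e (fst a) (fst c)" "e (snd a) (snd r) = e (snd a) (snd c)"
      unfolding d_def by linarith+
    then have "fst r = fst c" "snd r = snd c"
      using r(4) fst_r(2) snd_r(2) unfolding mem_rectangle by blast+
    with r(3) show False by (simp add: prod_eq_iff)
  qed
  with c that show thesis by blast
qed

lemma framed_union_margin: "Y \<subseteq> non_margin n \<Longrightarrow> framed n (Y \<union> margin n)"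
  unfolding framed_def by blast

text \<open>The only place where satisfaction of \<open>Y\<close> enters the choice of the
  order.\<close>

lemma sort_index_less_crossing:
  assumes Y: "satisfied Y" "Y \<subseteq> non_margin n"
    and g: "g \<in> links True n (Y \<union> margin n)" and v: "v \<in> links False n (Y \<union> margin n)"
    and "crosses g v" and h: "h \<in> links True n (Y \<union> margin n)" and "touches v h"
  shows "sort_index h < sort_index g"
proof -
  let ?P = "Y \<union> margin n"
  have P: "framed n ?P" using Y(2) by (rule framed_union_margin)
  have "finite Y" using framed_finite[OF P] by simp
  obtain x\<^sub>1 y x\<^sub>2 y0 where g_eq: "g = ((x\<^sub>1, y), (x\<^sub>2, y0))" by (metis prod.exhaust)
  obtain x y\<^sub>1 x0 y\<^sub>2 where v_eq: "v = ((x, y\<^sub>1), (x0, y\<^sub>2))" by (metis prod.exhaust)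
  obtain l y' r y0' where h_eq: "h = ((l, y'), (r, y0'))" by (metis prod.exhaust)
  note G = links_D[OF g[unfolded g_eq], unfolded co_def, simplified]
  note V = links_D[OF v[unfolded v_eq], unfolded co_def, simplified]
  note H = links_D[OF h[unfolded h_eq], unfolded co_def, simplified]
  have cross: "x\<^sub>1 < x" "x < x\<^sub>2" "y\<^sub>1 < y" "y < y\<^sub>2"
    using assms(5) by (simp_all add: crosses_def g_eq v_eq)
  have x: "x = l \<or> x = r" and y': "y' = y\<^sub>1 \<or> y' = y\<^sub>2"
    using assms(7) H(4) V(4) unfolding touches_eq v_eq h_eq by auto
  have in_Y: "(u, w) \<in> Y" if "(u, w) \<in> ?P" "1 \<le> u" "u \<le> n" "1 \<le> w" "w \<le> n" for u w
    using that by (auto simp: margin_iff)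
  have "(x, y') \<in> ?P" using y' V(1,2,4) by auto
  then have t: "(x, y') \<in> Y" using V(3) H(3) by (intro in_Y) simp_all
  \<comment> \<open>Here \<open>(z, y)\<close> is an end of \<open>g\<close>. A point of
    \<open>Y\<close> aligned with \<open>(x, y')\<close> in the rectangle cannot lie in the column
    of \<open>v\<close>, as it would be strictly between the ends of \<open>v\<close>. So it lies in
    row \<open>y'\<close> and limits how far the link \<open>h\<close> extends towards
    \<open>z\<close>.\<close>
  have towards: "\<exists>u. (u, y') \<in> Y \<and> u \<noteq> x \<and> min x z \<le> u \<and> u \<le> max x z"
    if z: "(z, y) \<in> Y" "z \<noteq> x" for z
  proof -
    obtain c where c: "c \<in> Y" "c \<in> rectangle (x, y') (z, y)" "c \<noteq> (x, y')" "fst c = x \<or> snd c = y'"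
      using exists_aligned_in_rectangle[OF Y(1) \<open>finite Y\<close> t z(1)] z(2) by auto
    obtain u w where uw: "c = (u, w)" by fastforce
    have "u \<noteq> x"
    proof
      assume "u = x"
      then have "w \<noteq> y'" "min y' y \<le> w" "w \<le> max y' y" using c uw by (auto simp: mem_rectangle)
      then have "y\<^sub>1 < w" "w < y\<^sub>2" using y' cross by auto
      then show False using V(6)[of "(x, w)"] c(1) uw \<open>u = x\<close> by auto
    qed
    then show ?thesis using c uw by (auto simp: mem_rectangle)
  qed
  have y: "1 \<le> y" "y \<le> n" "y0 = y" "y0' = y'" using G(3,4) H(4) by auto
  have far_l: "x\<^sub>1 \<le> l" if "x = r"
  proof (rule ccontr)
    assume far: "\<not> x\<^sub>1 \<le> l"
    \<comment> \<open>Satisfaction concerns \<open>Y\<close> only, so the end of \<open>g\<close>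
      must be off the margin; this follows from \<open>l\<close> being smaller than its
      abscissa.\<close>
    then have "(x\<^sub>1, y) \<in> Y" using G(1) y V(3) cross by (intro in_Y) auto
    then obtain u where "(u, y') \<in> Y" "u \<noteq> x" "min x x\<^sub>1 \<le> u" "u \<le> max x x\<^sub>1"
      using towards cross by blast
    then show False using H(6)[of "(u, y')"] far that cross by auto
  qed
  have far_r: "r \<le> x\<^sub>2" if "x = l"
  proof (rule ccontr)
    assume far: "\<not> r \<le> x\<^sub>2"
    \<comment> \<open>Symmetrically, an end of \<open>g\<close> to the left of \<open>r\<close>
      cannot be on the right margin.\<close>
    have "r \<le> n + 1" using framed_le[OF P, of "(r, y0')" False] H(2) by (simp add: co_def)
    then have "(x\<^sub>2, y) \<in> Y" using G(2) y far cross by (intro in_Y) auto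
    then obtain u where "(u, y') \<in> Y" "u \<noteq> x" "min x x\<^sub>2 \<le> u" "u \<le> max x x\<^sub>2"
      using towards cross by blast
    then show False using H(6)[of "(u, y')"] far that cross by auto
  qed
  show ?thesis using x
  proof
    assume "x = l"
    then show ?thesis using far_r cross by (auto simp: sort_index_def g_eq h_eq less_prod_def)
  next
    assume "x = r"
    then show ?thesis using far_l cross by (auto simp: sort_index_def g_eq h_eq less_prod_def)
  qed
qed

section \<open>Splitting and flipping along links\<close>

lemma links_interior:
  assumes "(p, q) \<in> links b n P"
  shows "c \<in> seg_interior (p, q) \<longleftrightarrow>
    co b c = co b p \<and> co (\<not> b) p < co (\<not> b) c \<and> co (\<not> b) c < co (\<not> b) q"
proof -
  note D = links_D[OF assms]
  have "c = p \<longleftrightarrow> co b c = co b p \<and> co (\<not> b) c = co (\<not> b) p"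
    "c = q \<longleftrightarrow> co b c = co b p \<and> co (\<not> b) c = co (\<not> b) q"
    using point_eqI[of b c p] point_eqI[of b c q] D(4) by metis+
  then show ?thesis
    unfolding seg_interior_def endpoints_def Diff_iff links_seg_points[OF assms] by auto
qed

lemma split_at_id: "(\<And>s. s \<in> L \<Longrightarrow> c \<notin> seg_interior s) \<Longrightarrow> split_at c L = L"
  by (auto simp: split_at_def)

lemma split_at_parts:
  assumes "s \<in> L" and "c \<in> seg_interior s"
  shows "(fst s, c) \<in> split_at c L" "(c, snd s) \<in> split_at c L"
  using assms unfolding split_at_def by blast+

lemma links_not_interior: "s \<in> links b n P \<Longrightarrow> c \<in> P \<Longrightarrow> c \<notin> seg_interior s"
  using links_endpoints[of s b n P] by (auto simp: seg_interior_def)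

lemma links_insert_iff:
  "(u, w) \<in> links b n (insert c P) \<longleftrightarrow>
    u \<in> insert c P \<and> w \<in> insert c P \<and> co b u \<in> {1..n} \<and> co b u = co b w \<and>
    co (\<not> b) u < co (\<not> b) w \<and>
    (\<forall>r\<in>P. co b r = co b u \<longrightarrow> co (\<not> b) r \<le> co (\<not> b) u \<or> co (\<not> b) w \<le> co (\<not> b) r) \<and>
    \<not> (co b c = co b u \<and> co (\<not> b) u < co (\<not> b) c \<and> co (\<not> b) c < co (\<not> b) w)"
  unfolding links_def consecutive_def between_def by (simp add: not_less) blast

lemma links_iff:
  "(u, w) \<in> links b n P \<longleftrightarrow>
    u \<in> P \<and> w \<in> P \<and> co b u \<in> {1..n} \<and> co b u = co b w \<and> co (\<not> b) u < co (\<not> b) w \<and>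
    (\<forall>r\<in>P. co b r = co b u \<longrightarrow> co (\<not> b) r \<le> co (\<not> b) u \<or> co (\<not> b) w \<le> co (\<not> b) r)"
  unfolding links_def consecutive_def between_def by (auto simp: not_less)

text \<open>A new point lies in the interior of exactly one link of its line, the one provided by
  \<open>link_over\<close>, and replaces it by two; a point already in \<open>P\<close> is interior
  to none.\<close>

lemma split_at_links:
  assumes P: "framed n P" and c: "co b c \<in> {1..n}" "co (\<not> b) c \<le> n + 1"
  shows "split_at c (links b n P) = links b n (insert c P)"
proof (cases "c \<in> P")
  case True
  then show ?thesis using links_not_interior by (simp add: insert_absorb split_at_id)
next
  case False
  then have "c \<notin> margin n" using P by (auto simp: framed_def)
  then have "co (\<not> b) c \<noteq> n + 1" using in_margin[OF c(1)] by blast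
  then obtain p q where pq: "(p, q) \<in> links b n P" "co b p = co b c"
    "co (\<not> b) p \<le> co (\<not> b) c" "co (\<not> b) c < co (\<not> b) q"
    using link_over[OF P c(1)] c(2) by (metis Suc_eq_plus1 le_SucE)
  note D = links_D[OF pq(1)]
  have "co (\<not> b) p \<noteq> co (\<not> b) c" using pq(2) D(1) False point_eqI[of b p c] by blast
  then have pc: "co (\<not> b) p < co (\<not> b) c" using pq(3) by simp
  show ?thesis
  proof (intro equalityI subsetI)
    fix s assume "s \<in> split_at c (links b n P)"
    then consider "s \<in> links b n P" "c \<notin> seg_interior s"
      | u w where "(u, w) \<in> links b n P" "c \<in> seg_interior (u, w)" "s = (u, c) \<or> s = (c, w)"
      unfolding split_at_def by force
    then show "s \<in> links b n (insert c P)"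
    proof cases
      case 1
      obtain u w where s: "s = (u, w)" by (metis prod.exhaust)
      have l: "(u, w) \<in> links b n P" using 1(1) s by simp
      have "\<not> (co b c = co b u \<and> co (\<not> b) u < co (\<not> b) c \<and> co (\<not> b) c < co (\<not> b) w)"
        using 1(2) links_interior[OF l] s by simp
      then show ?thesis unfolding s links_insert_iff using l[unfolded links_iff] by simp
    next
      case 2
      have i: "co b c = co b u" "co (\<not> b) u < co (\<not> b) c" "co (\<not> b) c < co (\<not> b) w"
        using 2(1,2) links_interior by blast+
      note D = links_D[OF 2(1)]
      have gap: "\<forall>r\<in>P. co b r = co b u \<longrightarrow> co (\<not> b) r \<le> co (\<not> b) u \<or> co (\<not> b) c \<le> co (\<not> b) r"
        "\<forall>r\<in>P. co b r = co b u \<longrightarrow> co (\<not> b) r \<le> co (\<not> b) c \<or> co (\<not> b) w \<le> co (\<not> b) r"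
        using D(6) i(2,3) by (meson le_trans less_imp_le)+
      have "(u, c) \<in> links b n (insert c P)"
        unfolding links_insert_iff using i D(1,3) gap(1) by simp
      moreover have "(c, w) \<in> links b n (insert c P)"
        unfolding links_insert_iff using i D(2-4) gap(2) by simp
      ultimately show ?thesis using 2(3) by blast
    qed
  next
    fix s assume s: "s \<in> links b n (insert c P)"
    obtain u w where uw: "s = (u, w)" by (metis prod.exhaust)
    note S = links_D[OF s[unfolded uw]]
    have c_in: "c \<in> seg_interior (p, q)" using pq pc by (simp add: links_interior)
    have old: "(p, c) \<in> split_at c (links b n P)" "(c, q) \<in> split_at c (links b n P)"
      using split_at_parts[OF pq(1) c_in] by simp_all
    consider "u \<noteq> c" "w \<noteq> c" | "u = c" "w \<noteq> c" | "u \<noteq> c" "w = c" using S(5) by blast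
    then show "s \<in> split_at c (links b n P)"
    proof cases
      case 1
      then have l: "(u, w) \<in> links b n P"
        using s[unfolded uw links_insert_iff] unfolding links_iff by simp
      then have "c \<notin> seg_interior (u, w)" using S(6)[of c] links_interior[OF l] by auto
      with l show ?thesis unfolding uw split_at_def by blast
    next
      case 2
      then have "w \<in> P" using S(2) by simp
      have "co (\<not> b) w \<le> co (\<not> b) q" using S(6)[of q] D 2(1) pq by auto
      moreover have "co (\<not> b) q \<le> co (\<not> b) w"
        using D(6)[OF \<open>w \<in> P\<close>] S(4,5) 2(1) pq pc by auto
      ultimately have "w = q" using S(4) D(4) pq(2) 2(1) by (intro point_eqI[of b]) simp_all
      then show ?thesis using old(2) 2(1) uw by simp
    next
      case 3
      then have "u \<in> P" using S(1) by simp
      have "co (\<not> b) p \<le> co (\<not> b) u" using S(6)[of p] S(4) D 3(2) pq pc by auto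
      moreover have "co (\<not> b) u \<le> co (\<not> b) p"
        using D(6)[OF \<open>u \<in> P\<close>] S(4,5) 3(2) pq pc by auto
      ultimately have "u = p" using S(4) D(4) pq(2) 3(2) by (intro point_eqI[of b]) simp_all
      then show ?thesis using old(1) 3(2) uw by simp
    qed
  qed
qed

lemma seg_link: "(p, q) \<in> links b n P \<Longrightarrow> seg p q = (p, q)"
  by (cases b) (auto simp: links_iff seg_def co_def)

lemma framed_links_point:
  assumes "framed n Q" and "(p, q) \<in> links b n Q"
  shows "co b p \<in> {1..n}" "co b q \<in> {1..n}" "co (\<not> b) p \<le> n + 1" "co (\<not> b) q \<le> n + 1"
  using links_D[OF assms(2)] framed_le[OF assms(1)] by simp_all

lemma framed_between: "framed n P \<Longrightarrow> framed n Q \<Longrightarrow> A \<subseteq> Q \<Longrightarrow> framed n (P \<union> A)"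
  unfolding framed_def by blast

lemma links_antimono:
  "(p, q) \<in> links b n Q \<Longrightarrow> P \<subseteq> Q \<Longrightarrow> p \<in> P \<Longrightarrow> q \<in> P \<Longrightarrow> (p, q) \<in> links b n P"
  unfolding links_iff by blast

text \<open>No point of \<open>Q\<close>, hence none of \<open>P\<close>, lies between
  \<open>p\<close> and \<open>q\<close>. After the splits the segment from \<open>p\<close> to
  \<open>q\<close> is therefore already present, and the flip merely adds the two points.\<close>

lemma flip_link:
  assumes P: "framed n P" and Q: "framed n Q" and "P \<subseteq> Q" and pq: "(p, q) \<in> links b n Q"
  shows "flip p q (P, links b n P) = (P \<union> {p, q}, links b n (P \<union> {p, q}))"
proof -
  note p = framed_links_point[OF Q pq]
  have Pp: "framed n (insert p P)"
    using framed_between[OF P Q, of "{p}"] links_D(1)[OF pq] by simp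
  have "split_at q (split_at p (links b n P)) = links b n (insert q (insert p P))"
    by (simp only: split_at_links[OF P p(1,3)] split_at_links[OF Pp p(2,4)])
  moreover have "(p, q) \<in> links b n (insert q (insert p P))"
    using pq by (rule links_antimono) (use assms(3) links_D(1,2)[OF pq] in auto)
  moreover have "insert q (insert p P) = P \<union> {p, q}" by blast
  ultimately show ?thesis unfolding flip_def seg_link[OF pq] by (simp add: insert_absorb)
qed

lemma valid_state_vertical: "framed n P \<Longrightarrow> valid_state n (P, links False n P)"
  using valid_state_links[of n P "{}" "links False n P"] by simp

lemma legal_run_append:
  "legal_run n st xs st' \<Longrightarrow> legal_run n st' ys st'' \<Longrightarrow> legal_run n st (xs @ ys) st''"
  by (induction n st xs st' rule: legal_run.induct) auto

lemma remove_segments_Nil [simp]: "remove_segments [] st = st"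
  by (cases st) (simp add: remove_segments_def)

text \<open>Throughout, all vertical links of the current point set are present. The fixed target
  \<open>Q\<close> provides the gap needed by \<open>flip_link\<close>, whatever the order of
  \<open>vs\<close>.\<close>

lemma subdivide_run:
  assumes "framed n P" and Q: "framed n Q" and "P \<subseteq> Q" and "set vs \<subseteq> links False n Q"
    and "P' = P \<union> \<Union> (endpoints ` set vs)"
  shows "legal_run n (P, links False n P) (map (\<lambda>v. (v, [])) vs) (P', links False n P')"
  using assms(1,3-5)
proof (induction vs arbitrary: P)
  case Nil
  then show ?case by simp
next
  case (Cons v vs)
  obtain p q where v: "v = (p, q)" by (metis prod.exhaust)
  have pq: "(p, q) \<in> links False n Q" using Cons.prems(3) v by simp
  note D = links_D[OF pq]
  let ?R = "P \<union> {p, q}"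
  have R: "framed n ?R" "?R \<subseteq> Q"
    using framed_between[OF Cons.prems(1) Q, of "{p, q}"] Cons.prems(2) D(1,2) by simp_all
  have flip: "flip p q (P, links False n P) = (?R, links False n ?R)"
    using Cons.prems(1) Q Cons.prems(2) pq by (rule flip_link)
  have "p \<in> grid n - corners n" "q \<in> grid n - corners n"
    using framed_grid[OF Q] D(1,2) by blast+
  moreover have "vertical (seg p q)" using links_orientation(2)[OF pq] seg_link[OF pq] by simp
  ultimately have "valid_flip n p q (P, links False n P)"
    unfolding valid_flip_def flip using valid_state_vertical[OF R(1)] by blast
  moreover have "legal_run n (?R, links False n ?R) (map (\<lambda>v. (v, [])) vs) (P', links False n P')"
    using Cons.prems(3,4) v by (intro Cons.IH R) (auto simp: endpoints_def)
  ultimately show ?case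
    by (simp only: v list.map legal_run.simps flip remove_segments_Nil valid_state_vertical[OF R(1)] simp_thms)
qed

text \<open>\<open>D\<close> holds the pieces already added and \<open>R\<close> those still to
  come. If a piece of \<open>R\<close> ends at \<open>p\<close>, every vertical link at
  \<open>p\<close> touches it and is kept; otherwise all horizontal links at \<open>p\<close> are in
  \<open>D\<close>. The two sets may overlap, which covers the moment between a flip and its
  removals.\<close>

lemma valid_state_sweep:
  assumes Y: "satisfied Y" "Y \<subseteq> non_margin n" and P: "P = Y \<union> margin n"
    and D: "D \<union> R = links True n P"
    and order: "\<And>d h. d \<in> D \<Longrightarrow> h \<in> R \<Longrightarrow> sort_index d \<le> sort_index h"
  shows "valid_state n (P, D \<union> {v \<in> links False n P. \<exists>h\<in>R. touches v h})"
proof (rule valid_state_links)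
  show "framed n P" unfolding P using Y(2) by (rule framed_union_margin)
  show "D \<subseteq> links True n P" using D by blast
  show "{v \<in> links False n P. \<exists>h\<in>R. touches v h} \<subseteq> links False n P" by blast
next
  fix g v assume g: "g \<in> D" and "v \<in> {v \<in> links False n P. \<exists>h\<in>R. touches v h}"
  then obtain h where v: "v \<in> links False n P" "h \<in> R" "touches v h" by blast
  show "\<not> crosses g v"
  proof
    assume "crosses g v"
    then have "sort_index h < sort_index g"
      using sort_index_less_crossing[OF Y, of g v h] g v D unfolding P by blast
    with order[OF g v(2)] show False by simp
  qed
next
  fix p assume "p \<in> P \<inter> non_margin n"
  show "(\<forall>v\<in>links False n P. p \<in> endpoints v \<longrightarrow> v \<in> {v \<in> links False n P. \<exists>h\<in>R. touches v h}) \<or>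
      (\<forall>g\<in>links True n P. p \<in> endpoints g \<longrightarrow> g \<in> D)"
    using D unfolding touches_def by blast
qed

lemma flip_present:
  assumes "(p, q) \<in> links True n P" and "L \<subseteq> links True n P \<union> links False n P"
  shows "flip p q (P, L) = (P, insert (p, q) L)"
proof -
  note D = links_D[OF assms(1)]
  have "split_at c L = L" if "c \<in> P" for c
    using that assms(2) links_not_interior by (intro split_at_id) blast
  then show ?thesis unfolding flip_def using D(1,2) seg_link[OF assms(1)] by auto
qed

lemma sweep_run:
  assumes Y: "satisfied Y" "Y \<subseteq> non_margin n" and P: "P = Y \<union> margin n"
    and V: "set V = links False n P" and "D \<union> set gs = links True n P"
    and "sorted (map sort_index gs)"
    and "\<And>d h. d \<in> D \<Longrightarrow> h \<in> set gs \<Longrightarrow> sort_index d \<le> sort_index h"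
  shows "legal_run n (P, D \<union> {v \<in> links False n P. \<exists>h\<in>set gs. touches v h}) (sweep V gs)
    (P, links True n P)"
  using assms(5-7)
proof (induction gs arbitrary: D)
  case Nil
  \<comment> \<open>With no piece to come, no vertical link is kept and \<open>D\<close> is the set
    of all horizontal links.\<close>
  then show ?case by simp
next
  case (Cons g gs)
  let ?W = "\<lambda>hs. {v \<in> links False n P. \<exists>h\<in>set hs. touches v h}"
  obtain p q where g: "g = (p, q)" by (metis prod.exhaust)
  have pq: "(p, q) \<in> links True n P" using Cons.prems(1) g by auto
  have framed: "framed n P" unfolding P using Y(2) by (rule framed_union_margin)
  have flip: "flip p q (P, D \<union> ?W (g # gs)) = (P, insert g D \<union> ?W (g # gs))"
    using flip_present[OF pq, of "D \<union> ?W (g # gs)"] Cons.prems(1) g by auto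
  have order: "sort_index d \<le> sort_index h" if "d \<in> insert g D" "h \<in> set (g # gs)" for d h
    using that Cons.prems(2) Cons.prems(3)[of d h] by auto
  \<comment> \<open>Directly after the flip, \<open>g\<close> counts both as added and as still to
    come, so its vertical links are kept.\<close>
  have "valid_state n (P, insert g D \<union> ?W (g # gs))"
    using Y P _ order by (rule valid_state_sweep) (use Cons.prems(1) in auto)
  moreover have "p \<in> grid n - corners n" "q \<in> grid n - corners n"
    using framed_grid[OF framed] links_D(1,2)[OF pq] by blast+
  moreover have "horizontal (seg p q)" using links_orientation(1)[OF pq] seg_link[OF pq] by simp
  ultimately have "valid_flip n p q (P, D \<union> ?W (g # gs))"
    unfolding valid_flip_def flip by blast
  moreover have "valid_state n (P, insert g D \<union> ?W gs)"
    using Y P _ order by (rule valid_state_sweep) (use Cons.prems(1) in auto)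
  moreover have "remove_segments (filter (\<lambda>v. \<not> (\<exists>h\<in>set gs. touches v h)) V)
      (P, insert g D \<union> ?W (g # gs)) = (P, insert g D \<union> ?W gs)"
  proof -
    \<comment> \<open>The removal list contains vertical links only, so no horizontal piece is
      lost.\<close>
    have "d \<notin> links False n P" if "d \<in> insert g D" for d
      using that Cons.prems(1) links_orientation horizontal_not_vertical by (metis UnI1 UnI2 insertE list.set_intros(1))
    then show ?thesis unfolding remove_segments_def by (auto simp: V)
  qed
  moreover have "legal_run n (P, insert g D \<union> ?W gs) (sweep V gs) (P, links True n P)"
  proof (rule Cons.IH)
    show "insert g D \<union> set gs = links True n P" using Cons.prems(1) by auto
    show "sorted (map sort_index gs)" using Cons.prems(2) by simp
    show "sort_index d \<le> sort_index h" if "d \<in> insert g D" "h \<in> set gs" for d h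
      using order that by simp
  qed
  ultimately show ?case by (simp only: g sweep.simps legal_run.simps flip[unfolded g] simp_thms)
qed

section \<open>Initial and end states\<close>

lemma vertical_link_iff:
  "((u, w), (u', w')) \<in> links False n P \<longleftrightarrow>
    u \<in> {1..n} \<and> u' = u \<and> (u, w) \<in> P \<and> (u, w') \<in> P \<and> w < w' \<and>
    (\<forall>z. (u, z) \<in> P \<longrightarrow> z \<le> w \<or> w' \<le> z)"
  by (auto simp: links_iff co_def)

text \<open>Since \<open>x\<close> is a permutation, every column contains exactly one point of
  \<open>X\<close>, and the vertical links of the column are the two segments from it to the margin.
  Thus the subdivision starts in a state of the form that it preserves.\<close>

lemma initial_state_links:
  assumes X: "perm_point_set X" and n: "n = card X"
  shows "initial_state X = (X \<union> margin n, links False n (X \<union> margin n))"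
proof -
  obtain x where x: "x permutes {1..n}" and X_eq: "X = (\<lambda>i. (x i, i)) ` {1..n}"
    using perm_point_setE[OF X] n by blast
  have sub: "X \<subseteq> non_margin n" using perm_point_set_subset[OF X] n by (simp add: non_margin_def)
  have unique: "w = w'" if "(u, w) \<in> X" "(u, w') \<in> X" for u w w'
    using that permutes_inj[OF x] unfolding X_eq by (auto dest: injD)
  have exists: "\<exists>w. (u, w) \<in> X" if "u \<in> {1..n}" for u
    using that permutes_image[OF x] unfolding X_eq by (metis (no_types, lifting) imageE image_eqI)
  have mem: "(u, w) \<in> X \<union> margin n \<longleftrightarrow> (u, w) \<in> X \<or> w = 0 \<or> w = n + 1" if "u \<in> {1..n}" for u w
    using that sub by (auto simp: margin_iff non_margin_def)
  have "s \<in> (\<Union>(x, y)\<in>X. {((x, 0), (x, y)), ((x, y), (x, n + 1))}) \<longleftrightarrow>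
      s \<in> links False n (X \<union> margin n)" for s
  proof -
    obtain u w u' w' where s: "s = ((u, w), (u', w'))" by (metis prod.exhaust)
    show ?thesis
    proof (cases "u \<in> {1..n}")
      case False
      then have "(u, v) \<notin> X" for v using sub by (auto simp: non_margin_def)
      then have "s \<notin> (\<Union>(x, y)\<in>X. {((x, 0), (x, y)), ((x, y), (x, n + 1))})" unfolding s by blast
      moreover have "s \<notin> links False n (X \<union> margin n)"
        using False links_D(3)[of "(u, w)" "(u', w')" False n] unfolding s co_def by fastforce
      ultimately show ?thesis by blast
    next
      case True
      then obtain v where v: "(u, v) \<in> X" using exists by blast
      then have v_bounds: "0 < v" "v < n + 1" using sub by (auto simp: non_margin_def)
      have "(u, z) \<in> X \<longleftrightarrow> z = v" for z using v unique by blast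
      then have col: "(u, z) \<in> X \<union> margin n \<longleftrightarrow> z = v \<or> z = 0 \<or> z = n + 1" for z
        using mem[OF True] by simp
      have "s \<in> links False n (X \<union> margin n) \<longleftrightarrow> u' = u \<and> (w = v \<or> w = 0 \<or> w = n + 1) \<and>
        (w' = v \<or> w' = 0 \<or> w' = n + 1) \<and> w < w' \<and>
        (\<forall>z. (z = v \<or> z = 0 \<or> z = n + 1) \<longrightarrow> z \<le> w \<or> w' \<le> z)"
        unfolding s vertical_link_iff col using True by blast
      also have "\<dots> \<longleftrightarrow> u' = u \<and> (w = 0 \<and> w' = v \<or> w = v \<and> w' = n + 1)"
        using v_bounds by auto
      also have "\<dots> \<longleftrightarrow> s \<in> (\<Union>(x, y)\<in>X. {((x, 0), (x, y)), ((x, y), (x, n + 1))})"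
        using v unique unfolding s by blast
      finally show ?thesis by blast
    qed
  qed
  then show ?thesis unfolding initial_state_def n by blast
qed

lemma end_state_links:
  assumes X: "perm_point_set X" and n: "n = card X" and "X \<subseteq> Y" and Y: "satisfied Y" "Y \<subseteq> non_margin n"
    and P: "P = Y \<union> margin n"
  shows "end_state X (P, links True n P)"
proof -
  have framed: "framed n P" unfolding P using Y(2) by (rule framed_union_margin)
  have "valid_state n (P, links True n P)"
    using valid_state_sweep[OF Y P, of "links True n P" "{}"] by simp
  moreover have "z \<in> (\<Union>s\<in>links True n P. seg_points s)" if z: "z \<in> {0..n + 1} \<times> {1..n}" for z
  proof -
    obtain x y where xy: "z = (x, y)" by (metis prod.exhaust)
    obtain p q where pq: "(p, q) \<in> links True n P" "snd p = y" "fst p \<le> x" "x \<le> fst q"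
    proof -
      \<comment> \<open>\<open>link_over\<close> covers half-open ranges and would miss column
        \<open>n + 1\<close>, whose points are right ends of the links over column
        \<open>n\<close>.\<close>
      define x' where "x' = min x n"
      have "co True (x', y) \<in> {1..n}" "co (\<not> True) (x', y) \<le> n"
        using z unfolding xy x'_def co_def by simp_all
      then obtain p q where "(p, q) \<in> links True n P" "co True p = co True (x', y)"
        "co (\<not> True) p \<le> co (\<not> True) (x', y)" "co (\<not> True) (x', y) < co (\<not> True) q"
        by (rule link_over[OF framed])
      moreover have "x \<le> n + 1" using z xy by simp
      ultimately show thesis
        by (intro that[of p q]) (auto simp: x'_def co_def min_def split: if_splits)
    qed
    then have "z \<in> seg_points (p, q)"
      using links_D(4)[OF pq(1)] unfolding links_seg_points[OF pq(1)] xy by (simp add: co_def)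
    with pq(1) show ?thesis by blast
  qed
  ultimately show ?thesis
    unfolding end_state_def initial_state_def using links_orientation(1) assms(3) P n by auto
qed

lemma margin_column:
  "(\<Union>u\<in>{1..n}. {mk b u 0, mk b u (n + 1)}) = {r \<in> margin n. co b r \<in> {1..n}}"
proof (intro equalityI subsetI)
  fix r assume "r \<in> (\<Union>u\<in>{1..n}. {mk b u 0, mk b u (n + 1)})"
  then obtain u where "u \<in> {1..n}" "r = mk b u 0 \<or> r = mk b u (n + 1)" by blast
  then show "r \<in> {r \<in> margin n. co b r \<in> {1..n}}"
    using in_margin[of b r n] by auto
next
  fix r assume r: "r \<in> {r \<in> margin n. co b r \<in> {1..n}}"
  then have "co (\<not> b) r = 0 \<or> co (\<not> b) r = n + 1"
    by (cases b) (auto simp: margin_iff co_def)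
  then have "r = mk b (co b r) 0 \<or> r = mk b (co b r) (n + 1)"
    using point_eqI[of b r "mk b (co b r) 0", unfolded co_mk]
      point_eqI[of b r "mk b (co b r) (n + 1)", unfolded co_mk] by blast
  with r show "r \<in> (\<Union>u\<in>{1..n}. {mk b u 0, mk b u (n + 1)})" by blast
qed

lemma set_border:
  assumes "Y \<subseteq> non_margin n" and "set ys = Y" and "co b ` set xs = {1..n}"
  shows "set (border b (n + 1) xs ys) = {r \<in> Y \<union> margin n. co b r \<in> {1..n}}"
proof -
  have "co b r \<in> {1..n}" if "r \<in> Y" for r
    using subsetD[OF assms(1) that] by (cases r) (auto simp: non_margin_def co_def)
  then have "{r \<in> Y. co b r \<in> {1..n}} = Y" by blast
  moreover have "set (border b (n + 1) xs ys) = (\<Union>u\<in>co b ` set xs. {mk b u 0, mk b u (n + 1)}) \<union> set ys"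
    by (auto simp: border_def)
  moreover have "{r \<in> Y \<union> margin n. co b r \<in> {1..n}} =
      {r \<in> margin n. co b r \<in> {1..n}} \<union> {r \<in> Y. co b r \<in> {1..n}}" by blast
  ultimately show ?thesis by (simp only: assms(2,3) margin_column)
qed

section \<open>The run of the transformation\<close>

text \<open>Bridges the gap between \<open>border\<close>, which lacks the margin points on the
  frame lines parallel to the links, and the full point set.\<close>

lemma links_restrict: "links b n {r \<in> P. co b r \<in> {1..n}} = links b n P"
proof -
  have "s \<in> links b n {r \<in> P. co b r \<in> {1..n}} \<longleftrightarrow> s \<in> links b n P" for s
  proof -
    obtain u w where s: "s = (u, w)" by (metis prod.exhaust)
    have "(\<forall>r\<in>{r \<in> P. co b r \<in> {1..n}}. co b r = co b u \<longrightarrow> Q r) \<longleftrightarrow>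
        (\<forall>r\<in>P. co b r = co b u \<longrightarrow> Q r)" if "co b u \<in> {1..n}" for Q
      using that by (metis (mono_tags, lifting) mem_Collect_eq)
    note restrict = this
    show ?thesis
    proof (cases "co b u \<in> {1..n}")
      case True
      then show ?thesis unfolding s links_iff restrict[OF True] mem_Collect_eq
        by (cases "co b u = co b w") simp_all
    next
      case False
      then show ?thesis unfolding s links_iff by blast
    qed
  qed
  then show ?thesis by blast
qed

lemma set_pieces:
  assumes "Y \<subseteq> non_margin n" and "set ys = Y" and "co b ` set xs = {1..n}"
  shows "set (pieces b (border b (n + 1) xs ys)) = links b n (Y \<union> margin n)"
proof -
  have "set (pieces b (border b (n + 1) xs ys)) = links b n {r \<in> Y \<union> margin n. co b r \<in> {1..n}}"
    unfolding pieces_def links_def set_filter set_product set_border[OF assms] by auto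
  then show ?thesis by (simp only: links_restrict)
qed

text \<open>The cost is the length of a list, whereas \<open>card_links\<close> counts a set.
  Distinctness rests on \<open>co b\<close> being injective on \<open>xs\<close> and on margin
  points lying outside \<open>non_margin n\<close>.\<close>

lemma distinct_pieces:
  assumes "distinct xs" and "inj_on (co b) (set xs)" and "distinct ys" and "set ys \<subseteq> non_margin n"
  shows "distinct (pieces b (border b (n + 1) xs ys))"
proof -
  have "distinct (border b (n + 1) xs ys)" using assms(1,2)
  proof (induction xs)
    case Nil
    then show ?case using assms(3) by (simp add: border_def)
  next
    case (Cons p xs)
    have "mk b (co b p) z \<notin> set (border b (n + 1) xs ys)" if "z \<in> {0, n + 1}" for z
    proof
      assume "mk b (co b p) z \<in> set (border b (n + 1) xs ys)"
      then consider r z' where "r \<in> set xs" "mk b (co b p) z = mk b (co b r) z'"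
        | "mk b (co b p) z \<in> non_margin n"
        using assms(4) by (auto simp: border_def)
      then show False
      proof cases
        case 1
        then have "co b p = co b r" by (metis co_mk(1))
        with 1(1) Cons.prems show False by (auto simp: inj_on_def)
      next
        case 2
        with that show False by (auto simp: non_margin_def mk_def split: if_splits)
      qed
    qed
    moreover have "mk b (co b p) 0 \<noteq> mk b (co b p) (n + 1)" by (simp add: mk_def)
    moreover have "distinct (border b (n + 1) xs ys)"
      using Cons by (simp add: inj_on_def)
    ultimately show ?case by (simp add: border_def)
  qed
  then show ?thesis by (simp add: pieces_def distinct_product)
qed

text \<open>A link is determined by its first endpoint, which is a point of \<open>Y\<close> or one
  of the \<open>n\<close> margin points with varying coordinate 0.\<close>

lemma card_links:
  assumes "Y \<subseteq> non_margin n"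
  shows "card (links b n (Y \<union> margin n)) \<le> card Y + n"
proof -
  let ?P = "Y \<union> margin n" and ?low = "(\<lambda>u. mk b u 0) ` {1..n}"
  have framed: "framed n ?P" using assms by (rule framed_union_margin)
  then have fin: "finite Y" using framed_finite by blast
  have "inj_on fst (links b n ?P)"
  proof (rule inj_onI)
    fix s t assume st: "s \<in> links b n ?P" "t \<in> links b n ?P" "fst s = fst t"
    obtain p q q' where pq: "s = (p, q)" "t = (p, q')" using st(3) by (metis prod.collapse)
    note S = links_D[OF st(1)[unfolded pq]] and T = links_D[OF st(2)[unfolded pq]]
    have "co (\<not> b) q \<le> co (\<not> b) q'" "co (\<not> b) q' \<le> co (\<not> b) q"
      using S(6)[OF T(2)] T(6)[OF S(2)] S(4,5) T(4,5) by simp_all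
    then have "q = q'" using S(4) T(4) by (intro point_eqI[of b]) simp_all
    then show "s = t" by (simp add: pq)
  qed
  then have "card (links b n ?P) = card (fst ` links b n ?P)" by (simp add: card_image)
  also have "\<dots> \<le> card (Y \<union> ?low)"
  proof (rule card_mono)
    show "finite (Y \<union> ?low)" using fin by simp
    show "fst ` links b n ?P \<subseteq> Y \<union> ?low"
    proof
      fix p assume "p \<in> fst ` links b n ?P"
      then obtain q where pq: "(p, q) \<in> links b n ?P" by force
      note D = links_D[OF pq]
      have lt: "co (\<not> b) p < n + 1" using D(5) framed_le[OF framed D(2), of "\<not> b"] by linarith
      show "p \<in> Y \<union> ?low"
      proof (cases "p \<in> Y")
        case False
        then have "p \<in> margin n" using D(1) by blast
        then have "co (\<not> b) p = 0" using D(3) lt by (cases b) (auto simp: margin_iff co_def)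
        then have "p = mk b (co b p) 0" by (intro point_eqI[of b]) simp_all
        with D(3) show ?thesis by blast
      qed simp
    qed
  qed
  also have "\<dots> \<le> card Y + card ?low" by (rule card_Un_le)
  also have "card ?low \<le> n" using card_image_le[of "{1..n}" "\<lambda>u. mk b u 0"] by simp
  finally show ?thesis by simp
qed

lemma length_sweep [simp]: "length (sweep V gs) = length gs"
  by (induction gs) simp_all

text \<open>Every point of \<open>Y\<close> is the lower end of some vertical link, so flipping
  along all vertical links brings in all of \<open>Y\<close>.\<close>

lemma subdivided_points:
  assumes "framed n (Y \<union> margin n)" and "X \<subseteq> Y" and Y: "Y \<subseteq> non_margin n"
  shows "(X \<union> margin n) \<union> \<Union> (endpoints ` links False n (Y \<union> margin n)) = Y \<union> margin n"
proof (intro equalityI subsetI)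
  fix p assume "p \<in> (X \<union> margin n) \<union> \<Union> (endpoints ` links False n (Y \<union> margin n))"
  then show "p \<in> Y \<union> margin n" using assms(2) links_endpoints by blast
next
  fix p assume "p \<in> Y \<union> margin n"
  then consider "p \<in> margin n" | "p \<in> Y" by blast
  then show "p \<in> (X \<union> margin n) \<union> \<Union> (endpoints ` links False n (Y \<union> margin n))"
  proof cases
    case 2
    then have "p \<in> Y \<union> margin n" "co False p \<in> {1..n}" "co (\<not> False) p \<le> n"
      using Y by (auto simp: non_margin_def co_def)
    then obtain q where "(p, q) \<in> links False n (Y \<union> margin n)" by (rule link_after[OF assms(1)])
    then show ?thesis unfolding endpoints_def by force
  qed blast
qed

lemma transform_correct:
  assumes X: "perm_point_set X" and Y: "superset_solution X Y"
  shows "rectangulation_solution X (transform (X, Y))"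
    and "length (transform (X, Y)) \<le> 4 * card Y"
proof -
  define n where "n = card X"
  let ?xs = "sorted_list_of_set X" and ?ys = "sorted_list_of_set Y" and ?P = "Y \<union> margin n"
  have sat: "satisfied Y" and XY: "X \<subseteq> Y" and sub: "Y \<subseteq> non_margin n"
    using Y by (simp_all add: superset_solution_def non_margin_def n_def)
  have framed: "framed n ?P" using sub by (rule framed_union_margin)
  then have fin: "finite Y" "finite X" using framed_finite finite_subset[OF XY] by blast+
  obtain x where x: "x permutes {1..n}" and X_eq: "X = (\<lambda>i. (x i, i)) ` {1..n}"
    using perm_point_setE[OF X] n_def by blast
  have bij: "co b ` set ?xs = {1..n}" "inj_on (co b) (set ?xs)" for b
    using permutes_image[OF x] permutes_inj[OF x] fin(2) unfolding X_eq
    by (auto simp: co_def image_image inj_on_def dest: injD)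
  have len: "length ?xs = n" by (simp add: n_def)
  define S where "S b = pieces b (border b (n + 1) ?xs ?ys)" for b
  have S: "set (S b) = links b n ?P" for b
    unfolding S_def using sub fin bij(1) by (intro set_pieces) simp_all
  have "length (S b) \<le> card Y + n" for b
  proof -
    have "distinct (S b)"
      unfolding S_def using fin bij(2) sub by (intro distinct_pieces) simp_all
    then have "length (S b) = card (links b n ?P)" using S distinct_card by metis
    then show ?thesis using card_links[OF sub] by simp
  qed
  note len_S = this
  let ?G = "sort_key sort_index (S True)"
  have set_G: "set ?G = links True n ?P" using S[of True] by simp
  have T: "transform (X, Y) = map (\<lambda>v. (v, [])) (S False) @ sweep (S False) ?G"
    by (simp add: transform_def transform_lists_def Let_def S_def n_def)
  have "n \<le> card Y" unfolding n_def using fin(1) XY by (rule card_mono)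
  then show "length (transform (X, Y)) \<le> 4 * card Y"
    unfolding T using len_S[of True] len_S[of False] by simp
  have "framed n (X \<union> margin n)" using XY sub by (intro framed_union_margin) blast
  then have subdivided: "legal_run n (X \<union> margin n, links False n (X \<union> margin n)) (map (\<lambda>v. (v, [])) (S False))
      (?P, links False n ?P)"
  proof (rule subdivide_run[OF _ framed])
    show "X \<union> margin n \<subseteq> ?P" using XY by blast
    show "set (S False) \<subseteq> links False n ?P" using S by simp
    show "?P = X \<union> margin n \<union> \<Union> (endpoints ` set (S False))"
      unfolding S by (rule subdivided_points[OF framed XY sub, symmetric])
  qed
  \<comment> \<open>The sweep starts from the vertical links touched by some horizontal link, and
    these must be all of them. Each column contains a point of \<open>X\<close>, so no vertical link
    runs from margin to margin; its inner end starts a horizontal link.\<close>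
  have all_touch: "links False n ?P = {} \<union> {v \<in> links False n ?P. \<exists>h\<in>set ?G. touches v h}"
  proof -
    have "\<exists>h\<in>links True n ?P. touches v h" if v: "v \<in> links False n ?P" for v
    proof -
      obtain p q where pq: "v = (p, q)" by (metis prod.exhaust)
      note D = links_D[OF v[unfolded pq]]
      have "fst p \<in> x ` {1..n}" using D(3) unfolding permutes_image[OF x] by (simp add: co_def)
      then obtain i where i: "fst p = x i" "i \<in> {1..n}" by (rule imageE)
      then have "(fst p, i) \<in> ?P" using XY X_eq by auto
      from D(6)[OF this] have "i \<le> snd p \<or> snd q \<le> i" by (simp add: co_def)
      then have "snd p \<in> {1..n} \<or> snd q \<in> {1..n}"
        using i(2) D(5) framed_le[OF framed D(1), of True] framed_le[OF framed D(2), of True]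
        by (auto simp: co_def)
      moreover have "fst q = fst p" "fst p \<le> n" using D(3,4) by (simp_all add: co_def)
      ultimately obtain r where r: "r \<in> endpoints v" "r \<in> ?P" "snd r \<in> {1..n}" "fst r \<le> n"
      proof (elim disjE)
        assume "snd p \<in> {1..n}" "fst p \<le> n"
        then show thesis using D(1) by (intro that[of p]) (simp_all add: pq endpoints_def)
      next
        assume "snd q \<in> {1..n}" "fst q = fst p" "fst p \<le> n"
        then show thesis using D(2) by (intro that[of q]) (simp_all add: pq endpoints_def)
      qed
      have "co True r \<in> {1..n}" "co (\<not> True) r \<le> n" using r(3,4) by (simp_all add: co_def)
      then obtain s where "(r, s) \<in> links True n ?P" by (rule link_after[OF framed r(2)])
      moreover have "touches v (r, s)" using r(1) by (auto simp: touches_def endpoints_def)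
      ultimately show ?thesis by blast
    qed
    then show ?thesis unfolding set_G by blast
  qed
  have swept: "legal_run n (?P, links False n ?P) (sweep (S False) ?G) (?P, links True n ?P)"
    by (subst all_touch, rule sweep_run[OF sat sub refl])
      (use S set_G in simp_all)
  have "legal_run n (initial_state X) (transform (X, Y)) (?P, links True n ?P)"
    unfolding T initial_state_links[OF X n_def] using subdivided swept by (rule legal_run_append)
  moreover have "end_state X (?P, links True n ?P)"
    using end_state_links[OF X n_def XY sat sub refl] .
  ultimately show "rectangulation_solution X (transform (X, Y))"
    unfolding rectangulation_solution_def n_def[symmetric] by blast
qed

theorem theorem3:
  "\<exists>(T :: point set \<times> point set \<Rightarrow> step list) (C :: nat).
     polytime_on {(X, Y). perm_point_set X \<and> superset_solution X Y}
       (encode_pair encode_points encode_points) encode_steps T \<and>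
     (\<forall>A' :: point set \<Rightarrow> point set. superset_algorithm A' \<longrightarrow>
        (\<exists>A :: point set \<Rightarrow> step list.
           (\<forall>X. perm_point_set X \<longrightarrow> A X = T (X, A' X)) \<and>
           rectangulation_algorithm A \<and>
           (\<forall>X. perm_point_set X \<longrightarrow>
              rectangulation_cost (A X) \<le> C * superset_cost (A' X))))"
proof (intro exI conjI allI impI)
  show "polytime_on {(X, Y). perm_point_set X \<and> superset_solution X Y}
       (encode_pair encode_points encode_points) encode_steps transform"
    by (rule polytime_transform)
next
  fix A' :: "point set \<Rightarrow> point set" and X
  \<comment> \<open>Unification with this trivial equation fixes the schematic witness for
    \<open>A\<close>; the constant \<open>4\<close> is fixed likewise by the last
    \<open>show\<close>.\<close>
  show "transform (X, A' X) = transform (X, A' X)" ..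
next
  fix A' assume A': "superset_algorithm A'"
  then show "rectangulation_algorithm (\<lambda>X. transform (X, A' X))"
    using transform_correct(1) by (simp add: superset_algorithm_def rectangulation_algorithm_def)
  fix X assume "perm_point_set X"
  then show "rectangulation_cost (transform (X, A' X)) \<le> 4 * superset_cost (A' X)"
    using transform_correct(2) A'
    by (simp add: superset_algorithm_def rectangulation_cost_def superset_cost_def)
qed

end
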